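(* Let $k$ be an algebraically closed field of characteristic $p>0$, let $r\geq 1$ be an integer with $p^r+1>3$, and set $d=N=p^r+1$. Let $X\subset\mathbb{P}^{N}_k$ be the Fermat hypersurface defined by $X_0^d+X_1^d+\cdots+X_N^d=0$. Let $f:C=\mathbb{P}^1_k\rightarrow X$ be a rational curve of degree $e$. If $mN<e\leq (m+1)(N-1)$ for some integer $m$ with $0\leq m\leq N-3$, then $f$ is not very free.
   Context: A rational curve on $X$ is a morphism $f:\mathbb{P}^1_k\to X$; its degree is the degree of the line bundle $f^*\mathcal{O}_{\mathbb{P}^N}(1)$ on $\mathbb{P}^1_k$. Let $T_X$ be the tangent bundle of the smooth projective variety $X$. The rational curve $f$ is called very free if $f^*T_X$ is ample, i.e. $f^*T_X$ is a direct sum of line bundles $\mathcal{O}_{\mathbb{P}^1}(a_i)$ with all $a_i>0$. *)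

theory Defs
  imports "HOL-Computational_Algebra.Computational_Algebra"
begin

text \<open>
  Projective varieties over an algebraically closed field are treated classically, as sets of
  closed points with their regular functions. A vector in k^(n+1) is a function on the naturals
  that vanishes beyond n, and a point of projective n-space is a line through the origin with
  the origin removed.
\<close>

type_synonym 'k pt = "(nat \<Rightarrow> 'k) set"

definition punctured_line :: "(nat \<Rightarrow> 'k::field) \<Rightarrow> 'k pt" where
  "punctured_line v = {(\<lambda>i. c * v i) | c. c \<noteq> 0}"

definition proj :: "nat \<Rightarrow> 'k::field pt set" where
  "proj n = {punctured_line v | v. (\<forall>i>n. v i = 0) \<and> (\<exists>i\<le>n. v i \<noteq> 0)}"

definition exponents :: "nat \<Rightarrow> nat \<Rightarrow> (nat \<Rightarrow> nat) set" where
  "exponents n d = {\<alpha>. (\<forall>i>n. \<alpha> i = 0) \<and> (\<Sum>i\<le>n. \<alpha> i) = d}"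

text \<open>
  Forms are polynomial functions; this loses nothing, since an algebraically closed field is
  infinite. The zero form has every degree.
\<close>

definition form :: "nat \<Rightarrow> nat \<Rightarrow> ((nat \<Rightarrow> 'k::field) \<Rightarrow> 'k) \<Rightarrow> bool" where
  "form n d P \<longleftrightarrow>
    (\<exists>c. P = (\<lambda>v. \<Sum>\<alpha>\<in>exponents n d. c \<alpha> * (\<Prod>i\<le>n. v i ^ \<alpha> i)))"

definition zopen :: "nat \<Rightarrow> 'k::field pt set \<Rightarrow> 'k pt set \<Rightarrow> bool" where
  "zopen n X U \<longleftrightarrow>
    (\<exists>S. (\<forall>P\<in>S. \<exists>d. form n d P) \<and> U = {x \<in> X. \<exists>P\<in>S. \<forall>v\<in>x. P v \<noteq> 0})"

text \<open>
  Germs at a point are represented by total functions that are arbitrary away from a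
  neighbourhood of the point.
\<close>

definition regular_at :: "nat \<Rightarrow> 'k::field pt set \<Rightarrow> 'k pt \<Rightarrow> ('k pt \<Rightarrow> 'k) \<Rightarrow> bool" where
  "regular_at n X x g \<longleftrightarrow>
    (\<exists>U d P Q. zopen n X U \<and> x \<in> U \<and> form n d P \<and> form n d Q \<and>
      (\<forall>y\<in>U. \<forall>v\<in>y. Q v \<noteq> 0 \<and> g y = P v / Q v))"

definition morphism ::
  "nat \<Rightarrow> 'k::field pt set \<Rightarrow> nat \<Rightarrow> 'k pt set \<Rightarrow> ('k pt \<Rightarrow> 'k pt) \<Rightarrow> bool" where
  "morphism n X m Y f \<longleftrightarrow>
    f ` X \<subseteq> Y \<and>
    (\<forall>V. zopen m Y V \<longrightarrow> zopen n X {x \<in> X. f x \<in> V}) \<and>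
    (\<forall>x\<in>X. \<forall>g. regular_at m Y (f x) g \<longrightarrow> regular_at n X x (\<lambda>y. g (f y)))"

text \<open>
  A vector bundle is given by its fibres, which are linear subspaces of a space of functions,
  and by the condition that a set-theoretic section is regular in a neighbourhood of a point.
  The second component is only meaningful for sections in the sense of \<open>section_of\<close>; a local
  section is represented by any extension to all of the base, for instance by zero.
\<close>

record ('k, 'b) vbundle =
  fibre :: "'k pt \<Rightarrow> ('b \<Rightarrow> 'k) set"
  regular_section_at :: "'k pt \<Rightarrow> ('k pt \<Rightarrow> 'b \<Rightarrow> 'k) \<Rightarrow> bool"

definition section_of ::
  "'k pt set \<Rightarrow> ('k, 'b) vbundle \<Rightarrow> ('k pt \<Rightarrow> 'b \<Rightarrow> 'k) \<Rightarrow> bool" where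
  "section_of X E \<sigma> \<longleftrightarrow> (\<forall>y\<in>X. \<sigma> y \<in> fibre E y)"

definition bundle_iso ::
  "'k::field pt set \<Rightarrow> ('k, 'b) vbundle \<Rightarrow> ('k, 'c) vbundle \<Rightarrow> bool" where
  "bundle_iso X E F \<longleftrightarrow>
    (\<exists>\<phi>. (\<forall>x\<in>X. bij_betw (\<phi> x) (fibre E x) (fibre F x) \<and>
           (\<forall>s\<in>fibre E x. \<forall>t\<in>fibre E x.
              \<phi> x (\<lambda>b. s b + t b) = (\<lambda>c. \<phi> x s c + \<phi> x t c)) \<and>
           (\<forall>s\<in>fibre E x. \<forall>a. \<phi> x (\<lambda>b. a * s b) = (\<lambda>c. a * \<phi> x s c))) \<and>
         (\<forall>\<sigma>. section_of X E \<sigma> \<longrightarrow>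
           (\<forall>x\<in>X. regular_section_at E x \<sigma> \<longleftrightarrow>
                   regular_section_at F x (\<lambda>y. \<phi> y (\<sigma> y)))))"

text \<open>
  The line bundle \<open>\<O>(a)\<close> on X: its fibre at x consists of the functions on the punctured line x
  that are homogeneous of degree a (extended by zero), so that for a = 1 it is the dual of the
  line. Its regular sections are locally quotients of forms whose degrees differ by a.
\<close>

definition twisting_bundle ::
  "nat \<Rightarrow> 'k::field pt set \<Rightarrow> int \<Rightarrow> ('k, nat \<Rightarrow> 'k) vbundle" where
  "twisting_bundle n X a =
    \<lparr>fibre = (\<lambda>x. {s. (\<forall>v\<in>x. \<forall>c. c \<noteq> 0 \<longrightarrow> s (\<lambda>i. c * v i) = c powi a * s v) \<and>
                     (\<forall>v. v \<notin> x \<longrightarrow> s v = 0)}),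
     regular_section_at = (\<lambda>x \<sigma>.
       \<exists>U d e P Q. zopen n X U \<and> x \<in> U \<and> form n d P \<and> form n e Q \<and> int d - int e = a \<and>
         (\<forall>y\<in>U. \<forall>v\<in>y. Q v \<noteq> 0 \<and> \<sigma> y v = P v / Q v))\<rparr>"

text \<open>
  Tangent vectors of X at x are the derivations from the local ring of X at x to k. They are
  functions on representatives of germs, set to zero on functions that are not regular at x.
\<close>

definition tangent_space ::
  "nat \<Rightarrow> 'k::field pt set \<Rightarrow> 'k pt \<Rightarrow> (('k pt \<Rightarrow> 'k) \<Rightarrow> 'k) set" where
  "tangent_space n X x =
    {D. (\<forall>g h. regular_at n X x g \<longrightarrow> regular_at n X x h \<longrightarrow>
            D (\<lambda>y. g y + h y) = D g + D h \<and>
            D (\<lambda>y. g y * h y) = g x * D h + h x * D g \<and>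
            ((\<exists>U. zopen n X U \<and> x \<in> U \<and> (\<forall>y\<in>U. g y = h y)) \<longrightarrow> D g = D h)) \<and>
        (\<forall>g c. regular_at n X x g \<longrightarrow> D (\<lambda>y. c * g y) = c * D g) \<and>
        (\<forall>g. \<not> regular_at n X x g \<longrightarrow> D g = 0)}"

text \<open>
  A vector field is regular at x if it takes functions regular at x to functions regular at x.
\<close>

definition tangent_bundle ::
  "nat \<Rightarrow> 'k::field pt set \<Rightarrow> ('k, 'k pt \<Rightarrow> 'k) vbundle" where
  "tangent_bundle n X =
    \<lparr>fibre = tangent_space n X,
     regular_section_at = (\<lambda>x \<theta>.
       \<forall>g. regular_at n X x g \<longrightarrow> regular_at n X x (\<lambda>y. \<theta> y g))\<rparr>"

text \<open>
  The pullback of a bundle E on Y along a map f from X to Y. Its regular sections are locally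
  the combinations, with regular functions on X as coefficients, of sections of E composed
  with f.
\<close>

definition pullback ::
  "nat \<Rightarrow> 'k::field pt set \<Rightarrow> 'k pt set \<Rightarrow> ('k pt \<Rightarrow> 'k pt) \<Rightarrow> ('k, 'b) vbundle \<Rightarrow> ('k, 'b) vbundle"
  where
  "pullback n X Y f E =
    \<lparr>fibre = (\<lambda>x. fibre E (f x)),
     regular_section_at = (\<lambda>x \<sigma>.
       \<exists>(l::nat) g \<tau> U.
         (\<forall>j<l. regular_at n X x (g j) \<and>
                section_of Y E (\<tau> j) \<and> regular_section_at E (f x) (\<tau> j)) \<and>
         zopen n X U \<and> x \<in> U \<and>
         (\<forall>y\<in>U. \<sigma> y = (\<lambda>b. \<Sum>j<l. g j y * \<tau> j (f y) b)))\<rparr>"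

definition direct_sum :: "nat \<Rightarrow> (nat \<Rightarrow> ('k::field, 'b) vbundle) \<Rightarrow> ('k, nat \<times> 'b) vbundle" where
  "direct_sum l E =
    \<lparr>fibre = (\<lambda>x. {s. (\<forall>i<l. (\<lambda>b. s (i, b)) \<in> fibre (E i) x) \<and> (\<forall>i\<ge>l. \<forall>b. s (i, b) = 0)}),
     regular_section_at = (\<lambda>x \<sigma>. \<forall>i<l. regular_section_at (E i) x (\<lambda>y b. \<sigma> y (i, b)))\<rparr>"

abbreviation P1 :: "'k::field pt set" where
  "P1 \<equiv> proj 1"

text \<open>
  The degree of a line bundle on the projective line is the integer corresponding to it under
  the isomorphism of the Picard group with the integers that sends \<open>\<O>(1)\<close> to 1.
\<close>

definition line_bundle_degree :: "('k::field, 'b) vbundle \<Rightarrow> int \<Rightarrow> bool" where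
  "line_bundle_degree L e \<longleftrightarrow> bundle_iso P1 L (twisting_bundle 1 P1 e)"

definition ample_on_P1 :: "('k::field, 'b) vbundle \<Rightarrow> bool" where
  "ample_on_P1 E \<longleftrightarrow>
    (\<exists>l a. (\<forall>i<l. a i > 0) \<and> bundle_iso P1 E (direct_sum l (\<lambda>i. twisting_bundle 1 P1 (a i))))"

definition rational_curve :: "nat \<Rightarrow> 'k::field pt set \<Rightarrow> ('k pt \<Rightarrow> 'k pt) \<Rightarrow> bool" where
  "rational_curve n X f \<longleftrightarrow> morphism 1 P1 n X f"

definition curve_degree :: "nat \<Rightarrow> ('k::field pt \<Rightarrow> 'k pt) \<Rightarrow> int \<Rightarrow> bool" where
  "curve_degree n f e \<longleftrightarrow>
    line_bundle_degree (pullback 1 P1 (proj n) f (twisting_bundle n (proj n) 1)) e"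

definition very_free :: "nat \<Rightarrow> 'k::field pt set \<Rightarrow> ('k pt \<Rightarrow> 'k pt) \<Rightarrow> bool" where
  "very_free n X f \<longleftrightarrow> ample_on_P1 (pullback 1 P1 X f (tangent_bundle n X))"

definition fermat_hypersurface :: "nat \<Rightarrow> nat \<Rightarrow> 'k::field pt set" where
  "fermat_hypersurface d n = {x \<in> proj n. \<forall>v\<in>x. (\<Sum>i\<le>n. v i ^ d) = 0}"

end

theory Submission
  imports Defs
begin

text \<open>
  Let \<open>q = p^r\<close> and let the curve be given by forms \<open>F i\<close> of degree \<open>e\<close> in \<open>s, t\<close>, so that
  \<open>\<Sum> (F i)^(q+1) = 0\<close>. The tangent space of \<open>X\<close> along the curve consists of the vectors \<open>w\<close> with
  \<open>\<Sum> (F i)^q * w i = 0\<close>, modulo \<open>F\<close> itself. Since \<open>m N < e\<close>, linear algebra provides a form \<open>\<Lambda> \<noteq> 0\<close>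
  of degree \<open>e + m - 1\<close> such that every \<open>F i * \<Lambda>\<close> splits as \<open>s^(e+m) * B i + t^(e+m) * C i\<close>; this is
  a section of the pullback of \<open>T(-1)\<close> of the projective space, twisted by \<open>-m-1\<close>. By Frobenius,
  \<open>w \<mapsto> \<Sum> (B i / t^(e+m))^q * w i\<close> is then a cosection of the pulled back tangent bundle with
  values in \<open>\<O>(e - q (m + 1))\<close>, once
  \<open>\<Sum> (B i)^q * F i = 0\<close> is arranged. As \<open>e \<le> (m + 1) q\<close>, an ample bundle has no such
  cosection except zero, and if the cosection is zero then \<open>B\<close> is proportional to \<open>F\<close>; this forces
  \<open>B = 0\<close> because \<open>B\<close> has smaller degree, and hence \<open>t^(e+m)\<close> divides \<open>\<Lambda>\<close>, which is absurd.
\<close>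

subsection \<open>Polynomials over an algebraically closed field\<close>

text \<open>Taking \<open>q\<close>-th powers is additive, so the splitting of
  \<open>F i * \<Lambda>\<close> survives it: where both charts meet,
  \<open>(B i / t^(e+m))^q\<close> and \<open>(- C i / s^(e+m))^q\<close> differ by
  \<open>(\<Lambda> / (s t)^(e+m))^q * (F i)^q\<close>, which annihilates tangent vectors of
  \<open>X\<close>. The constants come from a count. The splitting asks that \<open>m\<close> middle
  coefficients of each of the \<open>N + 1\<close> products vanish, against \<open>e + m\<close>
  coefficients of \<Lambda>; \<open>(N + 1) m < e + m\<close> is \<open>m N < e\<close>. The bound
  \<open>m \<le> N - 3\<close> supplies a second independent solution when
  \<open>e = (m + 1) q\<close>. Tangent vectors are derivations of local rings, so the description
  by vectors \<open>w\<close> must be proved both ways. The hard direction lets \<open>w\<close> act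
  on germs: every form vanishing on the points of \<open>X\<close> must have zero derivative along
  \<open>w\<close>, a fact about the ideal of \<open>X\<close>. Ampleness enters through a single
  vector field along the curve, with prescribed value at one point and zero at another. Its pairing
  with the cosection is a global section of degree at most 0, hence constant, hence zero.\<close>

lemma infinite_UNIV_alg_closed: "infinite (UNIV :: 'k::alg_closed_field set)"
proof
  assume fin: "finite (UNIV :: 'k set)"
  define p :: "'k poly" where "p = (\<Prod>a\<in>UNIV. [:- a, 1:]) + 1"
  have deg: "degree (\<Prod>a\<in>(UNIV :: 'k set). [:- a, 1:]) = card (UNIV :: 'k set)"
    by (subst degree_prod_eq_sum_degree) auto
  have "card (UNIV :: 'k set) > 0"
    using fin by (simp add: card_gt_0_iff)
  then have "degree p > 0"
    unfolding p_def by (subst degree_add_eq_left) (auto simp: deg)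
  then obtain x where "poly p x = 0"
    using alg_closed_imp_poly_has_root by blast
  moreover have "poly (\<Prod>a\<in>(UNIV :: 'k set). [:- a, 1:]) x = 0"
    using fin by (auto simp: poly_prod intro!: bexI[of _ x])
  ultimately show False
    by (simp add: p_def)
qed

lemma poly_eq_0_if_vanishing:
  fixes p :: "'k::alg_closed_field poly"
  assumes "\<And>x. poly p x = 0"
  shows "p = 0"
  using poly_roots_finite[of p] infinite_UNIV_alg_closed assms by auto

lemma poly_eqI_alg_closed:
  fixes p :: "'k::alg_closed_field poly"
  assumes "\<And>x. poly p x = poly q x"
  shows "p = q"
  using poly_eq_0_if_vanishing[of "p - q"] assms by simp

text \<open>The derivative of \<open>p\<close> at a root \<open>x\<close> is the value of the
  cofactor there, so \<open>x\<close> is not a root of the cofactor and each linear factor split off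
  contributes one new root.\<close>

lemma card_roots_separable:
  fixes p :: "'k::alg_closed_field poly"
  assumes "p \<noteq> 0" and "\<And>a. poly p a = 0 \<Longrightarrow> poly (pderiv p) a \<noteq> 0"
  shows "card {x. poly p x = 0} = degree p"
  using assms
proof (induction "degree p" arbitrary: p)
  case 0
  then obtain c where "p = [:c:]"
    by (metis degree_eq_zeroE)
  with 0 show ?case
    by simp
next
  case (Suc n)
  then obtain x where x: "poly p x = 0"
    using alg_closed_imp_poly_has_root[of p] by auto
  then obtain q where p: "p = [:- x, 1:] * q"
    by (auto simp: poly_eq_0_iff_dvd dvd_def)
  have q0: "q \<noteq> 0"
    using Suc.prems p by auto
  have dp: "degree p = Suc (degree q)"
    unfolding p using q0 by (subst degree_mult_eq) auto
  have pd: "poly (pderiv p) a = (a - x) * poly (pderiv q) a + poly q a" for a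
    unfolding p pderiv_mult by (simp add: pderiv_pCons algebra_simps del: mult_pCons_left)
  have qx: "poly q x \<noteq> 0"
    using Suc.prems(2)[OF x] by (simp add: pd)
  have pa: "poly p a = (a - x) * poly q a" for a
    unfolding p by (simp add: algebra_simps)
  have "poly (pderiv q) a \<noteq> 0" if "poly q a = 0" for a
    using Suc.prems(2)[of a] that by (auto simp: pa pd)
  then have "card {a. poly q a = 0} = degree q"
    using Suc.hyps(2) dp q0 by (intro Suc.hyps(1)) auto
  moreover have "{a. poly p a = 0} = insert x {a. poly q a = 0}"
    by (auto simp: pa)
  ultimately show ?case
    using qx poly_roots_finite[OF q0] dp by simp
qed

subsection \<open>Forms\<close>

lemma finite_exponents: "finite (exponents n d)"
proof (rule finite_subset)
  show "exponents n d \<subseteq> {\<alpha>. \<forall>i. (i \<in> {..n} \<longrightarrow> \<alpha> i \<in> {..d}) \<and> (i \<notin> {..n} \<longrightarrow> \<alpha> i = 0)}"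
    unfolding exponents_def by (auto intro: member_le_sum)
  show "finite {\<alpha>::nat \<Rightarrow> nat. \<forall>i. (i \<in> {..n} \<longrightarrow> \<alpha> i \<in> {..d}) \<and> (i \<notin> {..n} \<longrightarrow> \<alpha> i = 0)}"
    by (rule finite_set_of_finite_funs) auto
qed

lemma form_cmult:
  assumes "form n d P"
  shows "form n d (\<lambda>v. a * P v)"
proof -
  obtain c where "P = (\<lambda>v. \<Sum>\<alpha>\<in>exponents n d. c \<alpha> * (\<Prod>i\<le>n. v i ^ \<alpha> i))"
    using assms unfolding form_def by blast
  then have "(\<lambda>v. a * P v) = (\<lambda>v. \<Sum>\<alpha>\<in>exponents n d. (a * c \<alpha>) * (\<Prod>i\<le>n. v i ^ \<alpha> i))"
    by (simp add: sum_distrib_left mult.assoc)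
  then show ?thesis
    unfolding form_def by (rule exI[where x = "\<lambda>\<alpha>. a * c \<alpha>"])
qed

lemma form_add:
  assumes "form n d P" "form n d Q"
  shows "form n d (\<lambda>v. P v + Q v)"
proof -
  obtain b c where "P = (\<lambda>v. \<Sum>\<alpha>\<in>exponents n d. b \<alpha> * (\<Prod>i\<le>n. v i ^ \<alpha> i))"
      and "Q = (\<lambda>v. \<Sum>\<alpha>\<in>exponents n d. c \<alpha> * (\<Prod>i\<le>n. v i ^ \<alpha> i))"
    using assms unfolding form_def by blast
  then have "(\<lambda>v. P v + Q v) = (\<lambda>v. \<Sum>\<alpha>\<in>exponents n d. (b \<alpha> + c \<alpha>) * (\<Prod>i\<le>n. v i ^ \<alpha> i))"
    by (simp add: sum.distrib distrib_right)
  then show ?thesis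
    unfolding form_def by (rule exI[where x = "\<lambda>\<alpha>. b \<alpha> + c \<alpha>"])
qed

lemma form_zero: "form n d (\<lambda>v. 0)"
  unfolding form_def by (rule exI[where x = "\<lambda>_. 0"]) simp

lemma form_sum:
  assumes "\<And>i. i \<in> I \<Longrightarrow> form n d (P i)"
  shows "form n d (\<lambda>v. \<Sum>i\<in>I. P i v)"
  using assms
  by (induction I rule: infinite_finite_induct) (auto intro: form_zero form_add)

lemma form_minus:
  assumes "form n d P" "form n d Q"
  shows "form n d (\<lambda>v. P v - Q v)"
  using form_add[OF assms(1) form_cmult[OF assms(2), of "-1"]] by simp

lemma form_monomial:
  assumes "\<alpha> \<in> exponents n d"
  shows "form n d (\<lambda>v. \<Prod>i\<le>n. v i ^ \<alpha> i)"
  unfolding form_def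
proof (rule exI[where x = "\<lambda>\<beta>. if \<beta> = \<alpha> then 1 else 0"], rule ext)
  fix v :: "nat \<Rightarrow> 'a"
  have "(\<Sum>\<beta>\<in>exponents n d. (if \<beta> = \<alpha> then 1 else 0) * (\<Prod>i\<le>n. v i ^ \<beta> i)) =
        (\<Sum>\<beta>\<in>exponents n d. if \<beta> = \<alpha> then (\<Prod>i\<le>n. v i ^ \<beta> i) else 0)"
    by (intro sum.cong) auto
  then show "(\<Prod>i\<le>n. v i ^ \<alpha> i) =
        (\<Sum>\<beta>\<in>exponents n d. (if \<beta> = \<alpha> then 1 else 0) * (\<Prod>i\<le>n. v i ^ \<beta> i))"
    using assms finite_exponents by (simp add: sum.delta')
qed

lemma form_mult:
  assumes "form n d P" "form n e Q"
  shows "form n (d + e) (\<lambda>v. P v * Q v)"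
proof -
  obtain b c where P: "P = (\<lambda>v. \<Sum>\<alpha>\<in>exponents n d. b \<alpha> * (\<Prod>i\<le>n. v i ^ \<alpha> i))"
      and Q: "Q = (\<lambda>v. \<Sum>\<alpha>\<in>exponents n e. c \<alpha> * (\<Prod>i\<le>n. v i ^ \<alpha> i))"
    using assms unfolding form_def by blast
  have eq: "(\<lambda>v. P v * Q v) = (\<lambda>v. \<Sum>\<alpha>\<in>exponents n d. \<Sum>\<beta>\<in>exponents n e.
      (b \<alpha> * c \<beta>) * (\<Prod>i\<le>n. v i ^ (\<alpha> i + \<beta> i)))"
    unfolding P Q by (simp add: sum_product power_add prod.distrib mult_ac)
  show ?thesis
    unfolding eq
  proof (intro form_sum form_cmult)
    fix \<alpha> \<beta>
    assume "\<alpha> \<in> exponents n d" "\<beta> \<in> exponents n e"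
    then have "(\<lambda>i. \<alpha> i + \<beta> i) \<in> exponents n (d + e)"
      by (auto simp: exponents_def sum.distrib)
    from form_monomial[OF this]
    show "form n (d + e) (\<lambda>v::nat \<Rightarrow> 'a. \<Prod>i\<le>n. v i ^ (\<alpha> i + \<beta> i))" .
  qed
qed

lemma form_one: "form n 0 (\<lambda>v. 1)"
  using form_monomial[of "\<lambda>_. 0" n 0] by (simp add: exponents_def)

lemma form_const: "form n 0 (\<lambda>v. a)"
  using form_cmult[OF form_one, of n a] by simp

lemma form_power:
  assumes "form n d P"
  shows "form n (k * d) (\<lambda>v. P v ^ k)"
  by (induction k) (auto intro: form_one form_mult assms)

lemma form_coord:
  assumes "j \<le> n"
  shows "form n 1 (\<lambda>v. v j)"
proof -
  have "(\<lambda>i. if i = j then 1 else 0) \<in> exponents n 1"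
    using assms by (auto simp: exponents_def)
  from form_monomial[OF this] have "form n 1 (\<lambda>v::nat \<Rightarrow> 'a. \<Prod>i\<le>n. v i ^ (if i = j then 1 else 0))" .
  moreover have "(\<Prod>i\<le>n. v i ^ (if i = j then 1 else 0)) = v j" for v :: "nat \<Rightarrow> 'a"
  proof -
    have "(\<Prod>i\<le>n. v i ^ (if i = j then 1 else 0)) = (\<Prod>i\<le>n. if i = j then v i else 1)"
      by (intro prod.cong) auto
    then show ?thesis
      using assms by simp
  qed
  ultimately show ?thesis
    by simp
qed

lemma form_homogeneous:
  assumes "form n d P"
  shows "P (\<lambda>i. c * v i) = c ^ d * P v"
proof -
  obtain b where P: "P = (\<lambda>v. \<Sum>\<alpha>\<in>exponents n d. b \<alpha> * (\<Prod>i\<le>n. v i ^ \<alpha> i))"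
    using assms unfolding form_def by blast
  have "(\<Prod>i\<le>n. (c * v i) ^ \<alpha> i) = c ^ d * (\<Prod>i\<le>n. v i ^ \<alpha> i)"
    if "\<alpha> \<in> exponents n d" for \<alpha>
  proof -
    have "(\<Prod>i\<le>n. c ^ \<alpha> i) = c ^ d"
      using that by (simp add: exponents_def flip: power_sum)
    then show ?thesis
      by (simp add: power_mult_distrib prod.distrib)
  qed
  then show ?thesis
    unfolding P by (simp add: sum_distrib_left mult.left_commute)
qed

text \<open>Isolates the expansion into monomials once, so that restricting a form to a line or a
  plane only needs polynomial functions to be closed under sums and products.\<close>

lemma form_closed:
  fixes v :: "'x \<Rightarrow> nat \<Rightarrow> 'k::field"
  assumes "form n d P"
    and const: "\<And>a. C (\<lambda>_. a)"
    and add: "\<And>g h. C g \<Longrightarrow> C h \<Longrightarrow> C (\<lambda>x. g x + h x)"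
    and mult: "\<And>g h. C g \<Longrightarrow> C h \<Longrightarrow> C (\<lambda>x. g x * h x)"
    and coords: "\<And>i. i \<le> n \<Longrightarrow> C (\<lambda>x. v x i)"
  shows "C (\<lambda>x. P (v x))"
proof -
  obtain b where P: "P = (\<lambda>v. \<Sum>\<alpha>\<in>exponents n d. b \<alpha> * (\<Prod>i\<le>n. v i ^ \<alpha> i))"
    using assms(1) unfolding form_def by blast
  have sum: "C (\<lambda>x. \<Sum>i\<in>I. g i x)" if "\<And>i. i \<in> I \<Longrightarrow> C (g i)"
    for I :: "(nat \<Rightarrow> nat) set" and g
    using that by (induction I rule: infinite_finite_induct) (auto intro: const add)
  have power: "C (\<lambda>x. g x ^ k)" if "C g" for g k
    by (induction k) (auto intro: const mult that)
  have prod: "C (\<lambda>x. \<Prod>i\<in>I. g i x)" if "\<And>i. i \<in> I \<Longrightarrow> C (g i)" for I :: "nat set" and g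
    using that by (induction I rule: infinite_finite_induct) (auto intro: const mult)
  show ?thesis
    unfolding P by (intro sum mult const prod power coords) auto
qed

lemma form_along_line:
  assumes "form n d P"
  shows "\<exists>p. \<forall>t. poly p t = P (\<lambda>i. u i + t * w i)"
  using assms
proof (rule form_closed[where C = "\<lambda>g. \<exists>p. \<forall>t. poly p t = g t" and v = "\<lambda>t i. u i + t * w i"])
  show "\<exists>p. \<forall>t. poly p t = a" for a
    by (rule exI[of _ "[:a:]"]) simp
  show "\<exists>p. \<forall>t. poly p t = g t + h t"
    if "\<exists>p. \<forall>t. poly p t = g t" "\<exists>p. \<forall>t. poly p t = h t" for g h
    using that by (metis poly_add)
  show "\<exists>p. \<forall>t. poly p t = g t * h t"
    if "\<exists>p. \<forall>t. poly p t = g t" "\<exists>p. \<forall>t. poly p t = h t" for g h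
    using that by (metis poly_mult)
  show "\<exists>p. \<forall>t. poly p t = u i + t * w i" for i
    by (rule exI[of _ "[:u i, w i:]"]) simp
qed

text \<open>The inner variable is the first component of \<open>x\<close>, the outer one the second.
  The nesting permits division in the outer variable over the ring of polynomials in the inner
  one.\<close>

lemma form_along_plane:
  fixes V :: "nat \<Rightarrow> 'k::field poly poly"
  assumes "form n d P"
  shows "\<exists>p. \<forall>x. poly (poly p [:snd x:]) (fst x) = P (\<lambda>i. poly (poly (V i) [:snd x:]) (fst x))"
  using assms
proof (rule form_closed[where C = "\<lambda>g. \<exists>p. \<forall>x. poly (poly p [:snd x:]) (fst x) = g x"
      and v = "\<lambda>x i. poly (poly (V i) [:snd x:]) (fst x)"])
  show "\<exists>p. \<forall>x. poly (poly p [:snd x:]) (fst x) = a" for a :: 'k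
    by (rule exI[of _ "[:[:a:]:]"]) simp
  show "\<exists>p. \<forall>x. poly (poly p [:snd x:]) (fst x) = g x + h x"
    if "\<exists>p. \<forall>x. poly (poly p [:snd x:]) (fst x) = g x"
       "\<exists>p. \<forall>x. poly (poly p [:snd x:]) (fst x) = h x" for g h :: "'k \<times> 'k \<Rightarrow> 'k"
    using that by (metis poly_add)
  show "\<exists>p. \<forall>x. poly (poly p [:snd x:]) (fst x) = g x * h x"
    if "\<exists>p. \<forall>x. poly (poly p [:snd x:]) (fst x) = g x"
       "\<exists>p. \<forall>x. poly (poly p [:snd x:]) (fst x) = h x" for g h :: "'k \<times> 'k \<Rightarrow> 'k"
    using that by (metis poly_mult)
qed blast

subsection \<open>Derivatives of forms along tangent vectors of the Fermat hypersurface\<close>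

text \<open>The formal derivative at \<open>t = 0\<close> along the line \<open>u + t * w\<close>.
  The polynomial selected by \<open>THE\<close> is unique because the field is infinite.\<close>

definition dir_deriv :: "((nat \<Rightarrow> 'k) \<Rightarrow> 'k::field) \<Rightarrow> (nat \<Rightarrow> 'k) \<Rightarrow> (nat \<Rightarrow> 'k) \<Rightarrow> 'k" where
  "dir_deriv P u w = poly (pderiv (THE p. \<forall>t. poly p t = P (\<lambda>i. u i + t * w i))) 0"

lemma dir_derivI:
  fixes P :: "(nat \<Rightarrow> 'k) \<Rightarrow> 'k::alg_closed_field"
  assumes "\<And>t. poly p t = P (\<lambda>i. u i + t * w i)"
  shows "dir_deriv P u w = poly (pderiv p) 0"
proof -
  have "(THE p. \<forall>t. poly p t = P (\<lambda>i. u i + t * w i)) = p"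
    using assms by (intro the_equality) (auto intro: poly_eqI_alg_closed)
  then show ?thesis
    by (simp add: dir_deriv_def)
qed

lemma dir_deriv_add:
  fixes P :: "(nat \<Rightarrow> 'k) \<Rightarrow> 'k::alg_closed_field"
  assumes "form n d P" "form n e Q"
  shows "dir_deriv (\<lambda>v. P v + Q v) u w = dir_deriv P u w + dir_deriv Q u w"
proof -
  obtain p where p: "\<And>t. poly p t = P (\<lambda>i. u i + t * w i)"
    using form_along_line[OF assms(1)] by metis
  obtain q where q: "\<And>t. poly q t = Q (\<lambda>i. u i + t * w i)"
    using form_along_line[OF assms(2)] by metis
  have "poly (p + q) t = P (\<lambda>i. u i + t * w i) + Q (\<lambda>i. u i + t * w i)" for t
    by (simp add: p q)
  from dir_derivI[of "p + q" "\<lambda>v. P v + Q v", OF this] show ?thesis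
    using dir_derivI[of p P, OF p] dir_derivI[of q Q, OF q] by (simp add: pderiv_add)
qed

lemma dir_deriv_mult:
  fixes P :: "(nat \<Rightarrow> 'k) \<Rightarrow> 'k::alg_closed_field"
  assumes "form n d P" "form n e Q"
  shows "dir_deriv (\<lambda>v. P v * Q v) u w = dir_deriv P u w * Q u + P u * dir_deriv Q u w"
proof -
  obtain p where p: "\<And>t. poly p t = P (\<lambda>i. u i + t * w i)"
    using form_along_line[OF assms(1)] by metis
  obtain q where q: "\<And>t. poly q t = Q (\<lambda>i. u i + t * w i)"
    using form_along_line[OF assms(2)] by metis
  have "poly (p * q) t = P (\<lambda>i. u i + t * w i) * Q (\<lambda>i. u i + t * w i)" for t
    by (simp add: p q)
  from dir_derivI[of "p * q" "\<lambda>v. P v * Q v", OF this] show ?thesis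
    using dir_derivI[of p P, OF p] dir_derivI[of q Q, OF q] p[of 0] q[of 0]
    by (simp add: pderiv_mult algebra_simps)
qed

lemma dir_deriv_const: "dir_deriv (\<lambda>v. a) u w = (0 :: 'k::alg_closed_field)"
  using dir_derivI[of "[:a:]" "\<lambda>v. a" u w] by simp

lemma dir_deriv_cmult:
  fixes P :: "(nat \<Rightarrow> 'k) \<Rightarrow> 'k::alg_closed_field"
  assumes "form n d P"
  shows "dir_deriv (\<lambda>v. a * P v) u w = a * dir_deriv P u w"
  using dir_deriv_mult[OF form_const[of n a] assms] by (simp add: dir_deriv_const)

lemma dir_deriv_diff:
  fixes P :: "(nat \<Rightarrow> 'k) \<Rightarrow> 'k::alg_closed_field"
  assumes "form n d P" "form n e Q"
  shows "dir_deriv (\<lambda>v. P v - Q v) u w = dir_deriv P u w - dir_deriv Q u w"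
  using dir_deriv_add[OF assms(1) form_cmult[OF assms(2), of "-1"]]
    dir_deriv_cmult[OF assms(2), of "-1"] by simp

lemma dir_deriv_coord: "dir_deriv (\<lambda>v. v j) u w = (w j :: 'k::alg_closed_field)"
  using dir_derivI[of "[:u j, w j:]" "\<lambda>v. v j" u w] by (simp add: pderiv_pCons)

definition nonzero_vec :: "nat \<Rightarrow> (nat \<Rightarrow> 'k::field) \<Rightarrow> bool" where
  "nonzero_vec n v \<longleftrightarrow> (\<forall>i>n. v i = 0) \<and> (\<exists>i\<le>n. v i \<noteq> 0)"

lemma pderiv_sum: "pderiv (\<Sum>i\<in>I. p i) = (\<Sum>i\<in>I. pderiv (p i))"
  by (induction I rule: infinite_finite_induct) (auto simp: pderiv_add)

lemma poly_poly_eval: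
  "poly (poly p y) s = poly (map_poly (\<lambda>c. poly c s) p) (poly y s)"
  for p :: "'k::comm_semiring_1 poly poly"
  by (induction p) (auto simp: map_poly_pCons)

text \<open>
  On the plane spanned by \<open>w\<close> and the \<open>c\<close>-th coordinate vector through \<open>u\<close>, where \<open>u c \<noteq> 0\<close>, the
  hypersurface becomes \<open>T^(q+1) + B s = 0\<close>, which for general \<open>s\<close> has \<open>q + 1\<close> distinct solutions
  \<open>T\<close>. So division with remainder shows that \<open>H\<close> is a multiple of the Fermat equation on
  this plane, and the Fermat equation vanishes to second order along \<open>w\<close>.
\<close>

lemma dir_deriv_vanishing_on_fermat:
  fixes H :: "(nat \<Rightarrow> 'k::alg_closed_field) \<Rightarrow> 'k" and u w :: "nat \<Rightarrow> 'k"
  assumes q: "of_nat q = (0 :: 'k)" "q > 0"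
    and H: "form n d H"
    and vanish: "\<And>v. nonzero_vec n v \<Longrightarrow> (\<Sum>i\<le>n. v i ^ (q + 1)) = 0 \<Longrightarrow> H v = 0"
    and u: "nonzero_vec n u" "(\<Sum>i\<le>n. u i ^ (q + 1)) = 0"
    and w: "\<forall>i>n. w i = 0" "(\<Sum>i\<le>n. u i ^ q * w i) = 0"
  shows "dir_deriv H u w = 0"
proof -
  obtain c where c: "c \<le> n" "u c \<noteq> 0"
    using u(1) by (auto simp: nonzero_vec_def)
  define V :: "nat \<Rightarrow> 'k poly poly"
    where "V i = (if i = c then [:0, 1:] else [:[:u i, w i:]:])" for i
  define pt where "pt s T i = (if i = c then T else u i + s * w i)" for s T :: 'k and i
  obtain p where "\<forall>x. poly (poly p [:snd x:]) (fst x)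
      = H (\<lambda>i. poly (poly (V i) [:snd x:]) (fst x))"
    using form_along_plane[OF H, of V] by blast
  moreover have "(\<lambda>i. poly (poly (V i) [:T:]) s) = pt s T" for s T
    by (auto simp: V_def pt_def)
  ultimately have p: "poly (poly p [:T:]) s = H (pt s T)" for s T
    by (metis fst_conv snd_conv)
  define B where "B = (\<Sum>i\<in>{..n} - {c}. [:u i, w i:] ^ (q + 1))"
  define G :: "'k poly poly" where "G = monom 1 (q + 1) + [:B:]"
  have dG: "degree G = q + 1"
    unfolding G_def by (subst degree_add_eq_left) (auto simp: degree_monom_eq)
  have lG: "coeff G (degree G) = 1"
    by (simp add: dG) (simp add: G_def)
  have G0: "G \<noteq> 0"
    using dG by auto
  \<comment> \<open>\<open>G\<close> is monic in \<open>T\<close>, so pseudo-division over the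
    coefficient ring is genuine division with remainder.\<close>
  obtain Q R where QR: "pseudo_divmod p G = (Q, R)"
    by (cases "pseudo_divmod p G")
  have pQR: "p = G * Q + R" and dR: "R = 0 \<or> degree R < q + 1"
    using pseudo_divmod[OF G0 QR] lG dG by simp_all
  \<comment> \<open>At \<open>s = 0\<close> the value of \<open>B\<close> is
    \<open>- (u c ^ (q + 1))\<close>, by the Fermat equation for \<open>u\<close>.\<close>
  have B0: "B \<noteq> 0"
  proof
    assume "B = 0"
    then have "poly B 0 = 0"
      by simp
    then have "(\<Sum>i\<in>{..n} - {c}. u i ^ (q + 1)) = 0"
      by (simp add: B_def poly_sum)
    then show False
      using u(2) c by (simp add: sum.remove[of "{..n}" c])
  qed
  have Gval: "poly (poly G [:T:]) s = T ^ (q + 1) + poly B s" for s T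
    by (simp add: G_def poly_monom)
  have R_vanish: "poly (coeff R i) s = 0" if s: "poly B s \<noteq> 0" for s i
  proof -
    define Rs where "Rs = map_poly (\<lambda>c. poly c s) R"
    define g where "g = monom 1 (q + 1) + [:poly B s:]"
    have dg: "degree g = q + 1"
      unfolding g_def by (subst degree_add_eq_left) (auto simp: degree_monom_eq)
    have gval: "poly g T = T ^ (q + 1) + poly B s" for T
      by (simp add: g_def poly_monom)
    have card: "card {T. poly g T = 0} = q + 1"
    proof -
      have "card {T. poly g T = 0} = degree g"
      proof (rule card_roots_separable)
        show "g \<noteq> 0"
          using dg by auto
        show "poly (pderiv g) a \<noteq> 0" if "poly g a = 0" for a
        proof -
          have "a \<noteq> 0"
            using that s by (auto simp: gval)
          moreover have "pderiv g = monom 1 q"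
            using q(1) by (simp add: g_def pderiv_add pderiv_monom pderiv_pCons)
          ultimately show ?thesis
            by (simp add: poly_monom)
        qed
      qed
      then show ?thesis
        by (simp add: dg)
    qed
    have root: "poly Rs T = 0" if T: "poly g T = 0" for T
    proof -
      have "T \<noteq> 0"
        using T s by (auto simp: gval)
      then have nz: "nonzero_vec n (pt s T)"
        using c u(1) w(1) by (auto simp: nonzero_vec_def pt_def)
      have "(\<Sum>i\<le>n. pt s T i ^ (q + 1)) = T ^ (q + 1) + (\<Sum>i\<in>{..n} - {c}. pt s T i ^ (q + 1))"
        using c by (simp add: sum.remove[of "{..n}" c] pt_def)
      also have "(\<Sum>i\<in>{..n} - {c}. pt s T i ^ (q + 1)) = poly B s"
        unfolding B_def poly_sum by (intro sum.cong) (auto simp: pt_def algebra_simps)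
      also have "T ^ (q + 1) + poly B s = 0"
        using T by (simp only: gval)
      finally have "poly (poly p [:T:]) s = 0"
        unfolding p by (intro vanish nz)
      then have "poly (poly R [:T:]) s = 0"
        using T by (simp add: pQR Gval gval)
      then show ?thesis
        by (simp add: Rs_def poly_poly_eval)
    qed
    have "Rs = 0"
    proof (rule ccontr)
      assume ne: "Rs \<noteq> 0"
      have "card {T. poly g T = 0} \<le> card {T. poly Rs T = 0}"
        using root ne by (intro card_mono poly_roots_finite) auto
      also have "\<dots> \<le> degree Rs"
        using ne by (rule card_poly_roots_bound)
      also have "\<dots> \<le> degree R"
        unfolding Rs_def by (intro degree_le) (auto simp: coeff_map_poly coeff_eq_0)
      finally have "q + 1 \<le> degree R"
        using card by simp
      with dR ne show False
        by (auto simp: Rs_def)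
    qed
    then show ?thesis
      unfolding Rs_def by (metis coeff_0 coeff_map_poly poly_0)
  qed
  have "R = 0"
  proof (rule poly_eqI)
    fix i
    \<comment> \<open>The factor \<open>B\<close> absorbs the finitely many \<open>s\<close> with
      \<open>poly B s = 0\<close>, where the roots are not distinct.\<close>
    have "coeff R i * B = 0"
    proof (rule poly_eq_0_if_vanishing)
      show "poly (coeff R i * B) s = 0" for s
        using R_vanish[of s i] by auto
    qed
    then show "coeff R i = coeff 0 i"
      using B0 by simp
  qed
  define g where "g = (\<Sum>i\<le>n. [:u i, w i:] ^ (q + 1))"
  have g: "poly G [:u c, w c:] = g"
    using c by (simp add: G_def g_def B_def poly_monom sum.remove[of "{..n}" c])
  \<comment> \<open>The line through \<open>u\<close> in direction \<open>w\<close> lies in the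
    plane, at \<open>T = u c + t * w c\<close>, and \<open>G\<close> restricts to the Fermat
    equation \<open>g\<close> on it.\<close>
  have line: "poly (g * poly Q [:u c, w c:]) t = H (\<lambda>i. u i + t * w i)" for t
  proof -
    have "poly (g * poly Q [:u c, w c:]) t = poly (poly p [:u c, w c:]) t"
      by (simp add: pQR \<open>R = 0\<close> g)
    also have "\<dots> = poly (poly p [:u c + t * w c:]) t"
      by (simp add: poly_poly_eval)
    also have "\<dots> = H (pt t (u c + t * w c))"
      by (rule p)
    also have "pt t (u c + t * w c) = (\<lambda>i. u i + t * w i)"
      by (auto simp: pt_def)
    finally show ?thesis .
  qed
  have "dir_deriv H u w = poly (pderiv (g * poly Q [:u c, w c:])) 0"
    by (rule dir_derivI) (rule line)
  moreover have "poly g 0 = 0"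
    using u(2) by (simp add: g_def poly_sum)
  moreover have "poly (pderiv g) 0 = 0"
  proof -
    \<comment> \<open>The factor \<open>q + 1\<close> from the power rule equals 1 in the
      field.\<close>
    have "poly (pderiv ([:u i, w i:] ^ (q + 1))) 0 = u i ^ q * w i" for i
      using q(1) by (simp add: pderiv_power_Suc pderiv_pCons del: power_Suc)
    then have "poly (pderiv g) 0 = (\<Sum>i\<le>n. u i ^ q * w i)"
      by (simp add: g_def pderiv_sum poly_sum)
    then show ?thesis
      using w(2) by simp
  qed
  ultimately show ?thesis
    by (simp add: pderiv_mult)
qed

subsection \<open>Regular functions and tangent vectors\<close>

lemma punctured_line_self: "v \<in> punctured_line v"
  unfolding punctured_line_def by (auto intro: exI[of _ 1])

lemma punctured_line_scale:
  assumes "c \<noteq> 0"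
  shows "punctured_line (\<lambda>i. c * v i) = punctured_line v"
proof
  show "punctured_line (\<lambda>i. c * v i) \<subseteq> punctured_line v"
    unfolding punctured_line_def using assms by (auto simp flip: mult.assoc)
  show "punctured_line v \<subseteq> punctured_line (\<lambda>i. c * v i)"
  proof
    fix z assume "z \<in> punctured_line v"
    then obtain k where "k \<noteq> 0" "z = (\<lambda>i. k * v i)"
      by (auto simp: punctured_line_def)
    then show "z \<in> punctured_line (\<lambda>i. c * v i)"
      unfolding punctured_line_def using assms by (auto intro!: exI[of _ "k / c"])
  qed
qed

lemma in_punctured_line_eq: "v \<in> punctured_line w \<Longrightarrow> punctured_line w = punctured_line v"
  using punctured_line_scale[of _ w] unfolding punctured_line_def[of w] by blast

lemma proj_memD:
  assumes "x \<in> proj n" "v \<in> x"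
  shows "x = punctured_line v" "nonzero_vec n v"
proof -
  obtain w where w: "x = punctured_line w" "nonzero_vec n w"
    using assms(1) by (auto simp: proj_def nonzero_vec_def)
  then show "x = punctured_line v"
    using assms(2) in_punctured_line_eq by blast
  show "nonzero_vec n v"
    using w assms(2) by (auto simp: punctured_line_def nonzero_vec_def)
qed

lemma proj_nonempty: "x \<in> proj n \<Longrightarrow> \<exists>v. v \<in> x"
  by (auto simp: proj_def intro: punctured_line_self)

lemma punctured_line_in_proj: "nonzero_vec n v \<Longrightarrow> punctured_line v \<in> proj n"
  by (auto simp: proj_def nonzero_vec_def)

lemma fermat_hypersurface_memD:
  assumes "x \<in> fermat_hypersurface d n" "v \<in> x"
  shows "(\<Sum>i\<le>n. v i ^ d) = 0"
  using assms by (auto simp: fermat_hypersurface_def)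

lemma fermat_hypersurface_subset: "fermat_hypersurface d n \<subseteq> proj n"
  by (auto simp: fermat_hypersurface_def)

lemma punctured_line_in_fermat:
  assumes "nonzero_vec n v" "(\<Sum>i\<le>n. v i ^ d) = 0"
  shows "punctured_line v \<in> fermat_hypersurface d n"
  unfolding fermat_hypersurface_def punctured_line_def
  using punctured_line_in_proj[OF assms(1)] assms(2)
  by (auto simp: punctured_line_def power_mult_distrib simp flip: sum_distrib_left)

lemma form_nonzero_on_line:
  assumes "form n d P" "x \<in> proj n" "v \<in> x" "v' \<in> x" "P v \<noteq> 0"
  shows "P v' \<noteq> 0"
proof -
  have "v' \<in> punctured_line v"
    using proj_memD[OF assms(2,3)] assms(4) by simp
  then obtain c where "c \<noteq> 0" "v' = (\<lambda>i. c * v i)"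
    by (auto simp: punctured_line_def)
  then show ?thesis
    using form_homogeneous[OF assms(1), of c v] assms(5) by simp
qed

lemma zopen_principal:
  assumes "form n d S"
  shows "zopen n X {x \<in> X. \<forall>v\<in>x. S v \<noteq> 0}"
  unfolding zopen_def by (rule exI[of _ "{S}"]) (use assms in auto)

lemma zopen_whole: "zopen n X X"
  using zopen_principal[OF form_one, of n X] by simp

lemma zopenE:
  assumes "zopen n X U" "x \<in> U"
  obtains d S where "form n d S" "x \<in> X" "\<forall>v\<in>x. S v \<noteq> 0"
    "\<And>y. y \<in> X \<Longrightarrow> \<forall>v\<in>y. S v \<noteq> 0 \<Longrightarrow> y \<in> U"
  using assms unfolding zopen_def by blast

text \<open>A form of \<open>regular_at\<close> whose neighbourhood is the locus where the
  denominator is nonzero; a germ then comes with one pair of forms, to which the quotient rule can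
  be applied.\<close>

definition fraction_at ::
  "nat \<Rightarrow> 'k::field pt set \<Rightarrow> 'k pt \<Rightarrow> ('k pt \<Rightarrow> 'k) \<Rightarrow> nat \<Rightarrow> ((nat \<Rightarrow> 'k) \<Rightarrow> 'k) \<Rightarrow> ((nat \<Rightarrow> 'k) \<Rightarrow> 'k) \<Rightarrow> bool"
  where
  "fraction_at n X x g d P Q \<longleftrightarrow> x \<in> X \<and> form n d P \<and> form n d Q \<and> (\<forall>v\<in>x. Q v \<noteq> 0) \<and>
    (\<forall>y\<in>X. \<forall>v\<in>y. Q v \<noteq> 0 \<longrightarrow> g y = P v / Q v)"

text \<open>A neighbourhood contains a principal one \<open>S \<noteq> 0\<close>, and this is
  absorbed by multiplying numerator and denominator by \<open>S\<close>.\<close>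

lemma regular_at_iff_fraction:
  assumes X: "X \<subseteq> proj n"
  shows "regular_at n X x g \<longleftrightarrow> (\<exists>d P Q. fraction_at n X x g d P Q)"
proof
  assume "regular_at n X x g"
  then obtain U d P Q where U: "zopen n X U" "x \<in> U" and PQ: "form n d P" "form n d Q"
    and g: "\<forall>y\<in>U. \<forall>v\<in>y. Q v \<noteq> 0 \<and> g y = P v / Q v"
    by (auto simp: regular_at_def)
  from U obtain e S where S: "form n e S" "x \<in> X" "\<forall>v\<in>x. S v \<noteq> 0"
    "\<And>y. y \<in> X \<Longrightarrow> \<forall>v\<in>y. S v \<noteq> 0 \<Longrightarrow> y \<in> U"
    by (rule zopenE) blast
  have "g y = P v * S v / (Q v * S v)" if "y \<in> X" "v \<in> y" "Q v * S v \<noteq> 0" for y v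
  proof -
    have "\<forall>v'\<in>y. S v' \<noteq> 0"
      using form_nonzero_on_line[OF S(1) _ that(2)] that X by auto
    then show ?thesis
      using g S(4)[OF that(1)] that by auto
  qed
  moreover have "\<forall>v\<in>x. Q v * S v \<noteq> 0"
    using g U S by auto
  ultimately have "fraction_at n X x g (d + e) (\<lambda>v. P v * S v) (\<lambda>v. Q v * S v)"
    using form_mult[OF PQ(1) S(1)] form_mult[OF PQ(2) S(1)] S(2)
    unfolding fraction_at_def by blast
  then show "\<exists>d P Q. fraction_at n X x g d P Q"
    by blast
next
  assume "\<exists>d P Q. fraction_at n X x g d P Q"
  then obtain d P Q where PQ: "fraction_at n X x g d P Q"
    by blast
  then have "zopen n X {x \<in> X. \<forall>v\<in>x. Q v \<noteq> 0}"
    unfolding fraction_at_def by (blast intro: zopen_principal)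
  with PQ show "regular_at n X x g"
    unfolding regular_at_def fraction_at_def
    by (intro exI[of _ "{x \<in> X. \<forall>v\<in>x. Q v \<noteq> 0}"] exI[of _ d] exI[of _ P] exI[of _ Q]) auto
qed

lemma fraction_at_add:
  assumes "fraction_at n X x g d P Q" "fraction_at n X x h e R S"
  shows "fraction_at n X x (\<lambda>y. g y + h y) (d + e)
    (\<lambda>v. P v * S v + Q v * R v) (\<lambda>v. Q v * S v)"
  using assms unfolding fraction_at_def
  by (auto intro!: form_add form_mult simp: add_frac_eq)

lemma fraction_at_mult:
  assumes "fraction_at n X x g d P Q" "fraction_at n X x h e R S"
  shows "fraction_at n X x (\<lambda>y. g y * h y) (d + e) (\<lambda>v. P v * R v) (\<lambda>v. Q v * S v)"
  using assms unfolding fraction_at_def by (auto intro!: form_mult)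

lemma fraction_at_const:
  assumes "x \<in> X"
  shows "fraction_at n X x (\<lambda>y. c) 0 (\<lambda>v. c) (\<lambda>v. 1)"
  using assms unfolding fraction_at_def by (auto intro: form_const form_one)

lemma regular_at_const:
  assumes "X \<subseteq> proj n" "x \<in> X"
  shows "regular_at n X x (\<lambda>y. c)"
  using fraction_at_const[OF assms(2)] regular_at_iff_fraction[OF assms(1)] by blast

lemma regular_at_add:
  assumes "X \<subseteq> proj n" "regular_at n X x g" "regular_at n X x h"
  shows "regular_at n X x (\<lambda>y. g y + h y)"
  using assms(2,3) fraction_at_add unfolding regular_at_iff_fraction[OF assms(1)] by blast

lemma regular_at_mult:
  assumes "X \<subseteq> proj n" "regular_at n X x g" "regular_at n X x h"
  shows "regular_at n X x (\<lambda>y. g y * h y)"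
  using assms(2,3) fraction_at_mult unfolding regular_at_iff_fraction[OF assms(1)] by blast

lemma regular_at_power:
  assumes "X \<subseteq> proj n" "x \<in> X" "regular_at n X x g"
  shows "regular_at n X x (\<lambda>y. g y ^ k)"
  by (induction k)
    (use assms(3) in \<open>auto intro: regular_at_const[OF assms(1,2)] regular_at_mult[OF assms(1)]\<close>)

lemma regular_at_sum:
  assumes "X \<subseteq> proj n" "x \<in> X" "\<And>i. i \<in> I \<Longrightarrow> regular_at n X x (g i)"
  shows "regular_at n X x (\<lambda>y. \<Sum>i\<in>I. g i y)"
  using assms(3)
  by (induction I rule: infinite_finite_induct)
    (auto intro: regular_at_const[OF assms(1,2)] regular_at_add[OF assms(1)])

text \<open>The affine coordinate \<open>x_a / x_c\<close>, independent of the chosen representative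
  at points of projective space. Where \<open>x_c\<close> vanishes the value 0 is only a
  placeholder.\<close>

definition coord_ratio :: "nat \<Rightarrow> nat \<Rightarrow> 'k::field pt \<Rightarrow> 'k" where
  "coord_ratio a c y = (SOME v. v \<in> y) a / (SOME v. v \<in> y) c"

lemma coord_ratio_eq:
  assumes "y \<in> proj n" "v \<in> y"
  shows "coord_ratio a c y = v a / v c"
proof -
  have "(SOME v. v \<in> y) \<in> punctured_line v"
    using assms proj_memD(1) someI by metis
  then show ?thesis
    by (auto simp: coord_ratio_def punctured_line_def)
qed

lemma fraction_at_coord_ratio:
  assumes "X \<subseteq> proj n" "x \<in> X" "v \<in> x" "v c \<noteq> 0" "a \<le> n" "c \<le> n"
  shows "fraction_at n X x (coord_ratio a c) 1 (\<lambda>v. v a) (\<lambda>v. v c)"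
proof -
  have "\<forall>v'\<in>x. v' c \<noteq> 0"
    using form_nonzero_on_line[OF form_coord[OF assms(6)] _ assms(3)] assms by blast
  then show ?thesis
    unfolding fraction_at_def
    using assms(2) form_coord[OF assms(5)] form_coord[OF assms(6)]
      coord_ratio_eq[OF subsetD[OF assms(1)]] by blast
qed

lemma regular_at_coord_ratio:
  assumes "X \<subseteq> proj n" "x \<in> X" "v \<in> x" "v c \<noteq> 0" "a \<le> n" "c \<le> n"
  shows "regular_at n X x (coord_ratio a c)"
  using fraction_at_coord_ratio[OF assms] regular_at_iff_fraction[OF assms(1)] by blast

section \<open>Derivations of the local ring at a point\<close>

lemma tangent_space_add:
  "D \<in> tangent_space n X x \<Longrightarrow> regular_at n X x g \<Longrightarrow> regular_at n X x h \<Longrightarrow>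
    D (\<lambda>y. g y + h y) = D g + D h"
  by (simp add: tangent_space_def)

lemma tangent_space_mult:
  "D \<in> tangent_space n X x \<Longrightarrow> regular_at n X x g \<Longrightarrow> regular_at n X x h \<Longrightarrow>
    D (\<lambda>y. g y * h y) = g x * D h + h x * D g"
  by (simp add: tangent_space_def)

lemma tangent_space_local:
  "D \<in> tangent_space n X x \<Longrightarrow> regular_at n X x g \<Longrightarrow> regular_at n X x h \<Longrightarrow>
    zopen n X U \<Longrightarrow> x \<in> U \<Longrightarrow> (\<And>y. y \<in> U \<Longrightarrow> g y = h y) \<Longrightarrow> D g = D h"
  unfolding tangent_space_def by blast

lemma tangent_space_cmult:
  "D \<in> tangent_space n X x \<Longrightarrow> regular_at n X x g \<Longrightarrow> D (\<lambda>y. c * g y) = c * D g"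
  by (simp add: tangent_space_def)

lemma tangent_space_const:
  assumes "X \<subseteq> proj n" "x \<in> X" "D \<in> tangent_space n X x"
  shows "D (\<lambda>y. c) = 0"
proof -
  have "D (\<lambda>y. 1) + 0 = D (\<lambda>y. 1) + D (\<lambda>y. 1)"
    using tangent_space_mult[OF assms(3) regular_at_const[OF assms(1,2), of 1]
        regular_at_const[OF assms(1,2), of 1]] by simp
  then have "D (\<lambda>y. 1) = 0"
    by (simp only: add_left_cancel)
  then show ?thesis
    using tangent_space_cmult[OF assms(3) regular_at_const[OF assms(1,2), of 1], of c] by simp
qed

lemma tangent_space_power_Suc:
  assumes "X \<subseteq> proj n" "x \<in> X" "D \<in> tangent_space n X x" "regular_at n X x g"
  shows "D (\<lambda>y. g y ^ Suc k) = of_nat (Suc k) * g x ^ k * D g"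
proof (induction k)
  case (Suc k)
  have "D (\<lambda>y. g y * g y ^ Suc k) = g x * D (\<lambda>y. g y ^ Suc k) + g x ^ Suc k * D g"
    by (rule tangent_space_mult) (auto intro!: assms regular_at_power[OF assms(1,2,4), of "Suc k", simplified])
  then show ?case
    unfolding Suc by (simp add: algebra_simps)
qed simp

lemma tangent_space_sum:
  assumes "X \<subseteq> proj n" "x \<in> X" "D \<in> tangent_space n X x"
    and "\<And>i. i \<in> I \<Longrightarrow> regular_at n X x (g i)"
  shows "D (\<lambda>y. \<Sum>i\<in>I. g i y) = (\<Sum>i\<in>I. D (g i))"
  using assms(4)
proof (induction I rule: infinite_finite_induct)
  case (insert i I)
  have "D (\<lambda>y. g i y + (\<Sum>i\<in>I. g i y)) = D (g i) + D (\<lambda>y. \<Sum>i\<in>I. g i y)"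
    using insert.prems by (intro tangent_space_add[OF assms(3)] regular_at_sum[OF assms(1,2)]) auto
  with insert show ?case
    by simp
qed (auto simp: tangent_space_const[OF assms(1-3)])

text \<open>The vector with entries \<open>v c * D (coord_ratio a c)\<close> lifts \<open>D\<close>
  to the ambient space; another chart changes the lift by a multiple of \<open>v\<close>, the
  ambiguity known from the Euler sequence. The reason is the product rule for
  \<open>x_a / x_c = (x_a / x_c') (x_c' / x_c)\<close>.\<close>

lemma tangent_space_change_chart:
  assumes X: "X \<subseteq> proj n" and x: "x \<in> X" "v \<in> x" and D: "D \<in> tangent_space n X x"
    and c: "c \<le> n" "v c \<noteq> 0" "c' \<le> n" "v c' \<noteq> 0" and a: "a \<le> n"
  shows "v c * D (coord_ratio a c) =
    v a * (v c / v c' * D (coord_ratio c' c)) + v c' * D (coord_ratio a c')"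
proof -
  have reg: "regular_at n X x (coord_ratio a c')" "regular_at n X x (coord_ratio c' c)"
      "regular_at n X x (coord_ratio a c)"
    using assms by (auto intro!: regular_at_coord_ratio)
  have zo: "zopen n X {y \<in> X. \<forall>v\<in>y. v c' \<noteq> 0}"
    by (rule zopen_principal[OF form_coord[OF c(3)]])
  have xin: "x \<in> {y \<in> X. \<forall>v\<in>y. v c' \<noteq> 0}"
    using form_nonzero_on_line[OF form_coord[OF c(3)] _ x(2)] x X c by blast
  have xP: "x \<in> proj n"
    using x X by blast
  have "D (coord_ratio a c) = D (\<lambda>y. coord_ratio a c' y * coord_ratio c' c y)"
  proof (rule tangent_space_local[OF D reg(3) regular_at_mult[OF X reg(1,2)] zo xin])
    fix y assume y: "y \<in> {y \<in> X. \<forall>v\<in>y. v c' \<noteq> 0}"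
    then obtain v where "v \<in> y" "y \<in> proj n"
      using X proj_nonempty by blast
    then show "coord_ratio a c y = coord_ratio a c' y * coord_ratio c' c y"
      using y by (simp add: coord_ratio_eq)
  qed
  also have "\<dots> = v a / v c' * D (coord_ratio c' c) + v c' / v c * D (coord_ratio a c')"
    using tangent_space_mult[OF D reg(1,2)] coord_ratio_eq[OF xP x(2)] by simp
  finally show ?thesis
    using c by (simp add: field_simps)
qed

text \<open>Apply \<open>D\<close> to the dehomogenised Fermat equation, which is zero near
  \<open>x\<close>. The power rule produces the factor \<open>q + 1\<close>, which is 1 in the
  field.\<close>

lemma tangent_space_fermat:
  fixes X :: "'k::field pt set"
  assumes X: "X = fermat_hypersurface (q + 1) n" and q: "of_nat q = (0 :: 'k)"
    and x: "x \<in> X" "v \<in> x" and D: "D \<in> tangent_space n X x" and c: "c \<le> n" "v c \<noteq> 0"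
  shows "(\<Sum>a\<le>n. v a ^ q * D (coord_ratio a c)) = 0"
proof -
  have XP: "X \<subseteq> proj n"
    using X fermat_hypersurface_subset by blast
  then have xP: "x \<in> proj n"
    using x by blast
  have reg: "regular_at n X x (coord_ratio a c)" if "a \<le> n" for a
    using regular_at_coord_ratio[OF XP x c(2) that c(1)] .
  define U where "U = {y \<in> X. \<forall>v\<in>y. v c \<noteq> 0}"
  have zo: "zopen n X U"
    unfolding U_def by (rule zopen_principal[OF form_coord[OF c(1)]])
  have xin: "x \<in> U"
    using form_nonzero_on_line[OF form_coord[OF c(1)] xP x(2)] x c by (auto simp: U_def)
  have "D (\<lambda>y. \<Sum>a\<le>n. coord_ratio a c y ^ Suc q) = D (\<lambda>y. 0)"
  proof (rule tangent_space_local[OF D _ _ zo xin])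
    show "regular_at n X x (\<lambda>y. \<Sum>a\<le>n. coord_ratio a c y ^ Suc q)"
      using reg by (intro regular_at_sum regular_at_power XP x) auto
    show "regular_at n X x (\<lambda>y. 0)"
      by (rule regular_at_const[OF XP x(1)])
    fix y assume y: "y \<in> U"
    then obtain v where v: "v \<in> y" "y \<in> proj n"
      using XP proj_nonempty unfolding U_def by blast
    have "(\<Sum>a\<le>n. coord_ratio a c y ^ Suc q) = (\<Sum>a\<le>n. v a ^ Suc q) / v c ^ Suc q"
      using coord_ratio_eq[OF v(2,1)] by (simp add: sum_divide_distrib power_divide)
    also have "(\<Sum>a\<le>n. v a ^ Suc q) = 0"
      using fermat_hypersurface_memD[of y "q + 1" n v] y v X by (simp add: U_def)
    finally show "(\<Sum>a\<le>n. coord_ratio a c y ^ Suc q) = 0"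
      by simp
  qed
  also have "\<dots> = 0"
    by (rule tangent_space_const[OF XP x(1) D])
  also have "D (\<lambda>y. \<Sum>a\<le>n. coord_ratio a c y ^ Suc q) =
      (\<Sum>a\<le>n. D (\<lambda>y. coord_ratio a c y ^ Suc q))"
    using reg by (intro tangent_space_sum[OF XP x(1) D] regular_at_power XP x) auto
  also have "\<dots> = (\<Sum>a\<le>n. coord_ratio a c x ^ q * D (coord_ratio a c))"
    using reg q by (intro sum.cong refl) (simp add: tangent_space_power_Suc[OF XP x(1) D] del: power_Suc)
  also have "\<dots> = (\<Sum>a\<le>n. v a ^ q * D (coord_ratio a c)) / v c ^ q"
    using coord_ratio_eq[OF xP x(2)] by (simp add: sum_divide_distrib power_divide)
  finally show ?thesis
    using c by simp
qed

text \<open>The derivation induced by the ambient vector \<open>w\<close> at \<open>u\<close>,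
  written as the quotient rule for \<open>P / Q\<close> with \<open>P u / Q u\<close> replaced by
  \<open>g x\<close>. That \<open>THE\<close> does not depend on the fraction is exactly where
  tangency of \<open>w\<close> is needed.\<close>

definition tangent_vector ::
  "nat \<Rightarrow> 'k::field pt set \<Rightarrow> 'k pt \<Rightarrow> (nat \<Rightarrow> 'k) \<Rightarrow> (nat \<Rightarrow> 'k) \<Rightarrow> ('k pt \<Rightarrow> 'k) \<Rightarrow> 'k" where
  "tangent_vector n X x u w g =
    (if regular_at n X x g
     then (THE z. \<exists>d P Q. fraction_at n X x g d P Q \<and>
             z = (dir_deriv P u w - g x * dir_deriv Q u w) / Q u)
     else 0)"

text \<open>The cross difference \<open>P S - R Q\<close> vanishes on \<open>X\<close> only near
  \<open>x\<close>; multiplying it by \<open>Q S T\<close>, with \<open>T\<close> cutting out the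
  neighbourhood, gives a form vanishing on all of \<open>X\<close>, whose derivative along
  \<open>w\<close> is zero. Since the difference vanishes at \<open>u\<close> and the multiplier
  does not, the derivative of the difference itself is zero.\<close>

lemma dir_deriv_fraction_unique:
  fixes X :: "'k::alg_closed_field pt set"
  assumes X: "X = fermat_hypersurface (q + 1) n" and q: "of_nat q = (0 :: 'k)" "q > 0"
    and x: "x \<in> X" "u \<in> x"
    and w: "\<forall>i>n. w i = 0" "(\<Sum>i\<le>n. u i ^ q * w i) = 0"
    and g: "fraction_at n X x g d P Q" and h: "fraction_at n X x h e R S"
    and U: "zopen n X U" "x \<in> U" "\<And>y. y \<in> U \<Longrightarrow> g y = h y"
  shows "(dir_deriv P u w - g x * dir_deriv Q u w) / Q u =
         (dir_deriv R u w - h x * dir_deriv S u w) / S u"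
proof -
  have XP: "X \<subseteq> proj n"
    using X fermat_hypersurface_subset by blast
  obtain k T where T: "form n k T" "\<forall>v\<in>x. T v \<noteq> 0"
    "\<And>y. y \<in> X \<Longrightarrow> \<forall>v\<in>y. T v \<noteq> 0 \<Longrightarrow> y \<in> U"
    using zopenE[OF U(1,2)] by metis
  have forms: "form n d P" "form n d Q" "form n e R" "form n e S"
    using g h by (auto simp: fraction_at_def)
  have Qu: "Q u \<noteq> 0" and Su: "S u \<noteq> 0" and Tu: "T u \<noteq> 0"
    using g h T x by (auto simp: fraction_at_def)
  have PQu: "P u = g x * Q u" and RSu: "R u = h x * S u"
    using g h x Qu Su by (auto simp: fraction_at_def)
  have ghx: "g x = h x"
    using U by blast
  define A where "A v = P v * S v - R v * Q v" for v
  define B where "B v = Q v * S v * T v" for v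
  have fA: "form n (d + e) A"
    unfolding A_def using form_minus[OF form_mult[OF forms(1,4)]] form_mult[OF forms(3,2)]
    by (simp add: add.commute)
  have fB: "form n (d + e + k) B"
    unfolding B_def by (intro form_mult forms T)
  have AB: "A v * B v = 0" if v: "nonzero_vec n v" "(\<Sum>i\<le>n. v i ^ (q + 1)) = 0" for v
  proof (cases "B v = 0")
    case False
    have y: "punctured_line v \<in> X"
      using punctured_line_in_fermat[OF v] X by blast
    have "punctured_line v \<in> U"
      using form_nonzero_on_line[OF T(1) _ punctured_line_self] y XP False
      by (intro T(3)) (auto simp: B_def)
    then have "P v / Q v = R v / S v"
      using U(3) g h y punctured_line_self False unfolding fraction_at_def B_def
      by (metis mult_eq_0_iff)
    then show ?thesis
      using False by (simp add: A_def B_def frac_eq_eq)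
  qed simp
  have "dir_deriv (\<lambda>v. A v * B v) u w = 0"
  proof (rule dir_deriv_vanishing_on_fermat[OF q form_mult[OF fA fB] AB _ _ w])
    show "nonzero_vec n u"
      using proj_memD x XP by blast
    show "(\<Sum>i\<le>n. u i ^ (q + 1)) = 0"
      using fermat_hypersurface_memD x X by blast
  qed auto
  moreover have "A u = 0"
    by (simp add: A_def PQu RSu ghx)
  moreover have "B u \<noteq> 0"
    by (simp add: B_def Qu Su Tu)
  ultimately have "dir_deriv A u w = 0"
    by (simp add: dir_deriv_mult[OF fA fB])
  then have "dir_deriv P u w * S u + P u * dir_deriv S u w
      - (dir_deriv R u w * Q u + R u * dir_deriv Q u w) = 0"
    unfolding A_def
    by (simp add: dir_deriv_diff[OF form_mult[OF forms(1,4)] form_mult[OF forms(3,2)]]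
        dir_deriv_mult[OF forms(1,4)] dir_deriv_mult[OF forms(3,2)])
  then show ?thesis
    using Qu Su by (simp add: PQu RSu ghx field_simps)
qed

lemma tangent_vector_eq:
  fixes X :: "'k::alg_closed_field pt set"
  assumes X: "X = fermat_hypersurface (q + 1) n" and q: "of_nat q = (0 :: 'k)" "q > 0"
    and x: "x \<in> X" "u \<in> x"
    and w: "\<forall>i>n. w i = 0" "(\<Sum>i\<le>n. u i ^ q * w i) = 0"
    and g: "fraction_at n X x g d P Q"
  shows "tangent_vector n X x u w g = (dir_deriv P u w - g x * dir_deriv Q u w) / Q u"
proof -
  have "regular_at n X x g"
    using regular_at_iff_fraction g X fermat_hypersurface_subset by blast
  moreover have "(THE z. \<exists>d P Q. fraction_at n X x g d P Q \<and>
             z = (dir_deriv P u w - g x * dir_deriv Q u w) / Q u)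
      = (dir_deriv P u w - g x * dir_deriv Q u w) / Q u"
    using g dir_deriv_fraction_unique[OF X q x w _ g zopen_whole x(1) refl]
    by (intro the_equality) blast+
  ultimately show ?thesis
    by (simp add: tangent_vector_def)
qed

lemma tangent_vector_in_tangent_space:
  fixes X :: "'k::alg_closed_field pt set"
  assumes X: "X = fermat_hypersurface (q + 1) n" and q: "of_nat q = (0 :: 'k)" "q > 0"
    and x: "x \<in> X" "u \<in> x"
    and w: "\<forall>i>n. w i = 0" "(\<Sum>i\<le>n. u i ^ q * w i) = 0"
  shows "tangent_vector n X x u w \<in> tangent_space n X x"
proof -
  let ?D = "tangent_vector n X x u w"
  have XP: "X \<subseteq> proj n"
    using X fermat_hypersurface_subset by blast
  note eq = tangent_vector_eq[OF X q x w]
  have main: "?D (\<lambda>y. g y + h y) = ?D g + ?D h \<and> ?D (\<lambda>y. g y * h y) = g x * ?D h + h x * ?D g \<and>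
      ((\<exists>U. zopen n X U \<and> x \<in> U \<and> (\<forall>y\<in>U. g y = h y)) \<longrightarrow> ?D g = ?D h)"
    if gh: "regular_at n X x g" "regular_at n X x h" for g h
  proof -
    obtain d P Q where g: "fraction_at n X x g d P Q"
      using gh regular_at_iff_fraction[OF XP] by blast
    obtain e R S where h: "fraction_at n X x h e R S"
      using gh regular_at_iff_fraction[OF XP] by blast
    have forms: "form n d P" "form n d Q" "form n e R" "form n e S"
      using g h by (auto simp: fraction_at_def)
    have nz: "Q u \<noteq> 0" "S u \<noteq> 0" and PQu: "P u = g x * Q u" "R u = h x * S u"
      using g h x by (auto simp: fraction_at_def)
    have add: "?D (\<lambda>y. g y + h y) = ?D g + ?D h"
      unfolding eq[OF fraction_at_add[OF g h]] eq[OF g] eq[OF h] using nz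
      by (simp add: dir_deriv_add[OF form_mult[OF forms(1,4)] form_mult[OF forms(2,3)]]
          dir_deriv_mult[OF forms(1,4)] dir_deriv_mult[OF forms(2,3)]
          dir_deriv_mult[OF forms(2,4)] PQu field_simps)
    have mult: "?D (\<lambda>y. g y * h y) = g x * ?D h + h x * ?D g"
      unfolding eq[OF fraction_at_mult[OF g h]] eq[OF g] eq[OF h] using nz
      by (simp add: dir_deriv_mult[OF forms(1,3)] dir_deriv_mult[OF forms(2,4)] PQu field_simps)
    have "?D g = ?D h" if "zopen n X U" "x \<in> U" "\<forall>y\<in>U. g y = h y" for U
      unfolding eq[OF g] eq[OF h]
      by (rule dir_deriv_fraction_unique[OF X q x w g h that(1,2)]) (use that in auto)
    with add mult show ?thesis
      by blast
  qed
  have "?D (\<lambda>y. c * g y) = c * ?D g" if "regular_at n X x g" for g c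
  proof -
    have "?D (\<lambda>y. c) = 0"
      by (simp add: eq[OF fraction_at_const[OF x(1)]] dir_deriv_const)
    then show ?thesis
      using main[OF regular_at_const[OF XP x(1), of c] that] by simp
  qed
  moreover have "?D g = 0" if "\<not> regular_at n X x g" for g
    using that by (simp add: tangent_vector_def)
  ultimately show ?thesis
    unfolding tangent_space_def using main by simp
qed

subsection \<open>Sections of line bundles on the projective line\<close>

text \<open>Homogenisation to degree \<open>d\<close> of a polynomial in \<open>v 1 / v 0\<close>;
  coefficients beyond \<open>d\<close> are dropped. Binary forms are handled as univariate
  polynomials this way, the coefficient at \<open>d\<close> being the value at the point at infinity
  \<open>v 0 = 0\<close>.\<close>

definition hom_eval :: "nat \<Rightarrow> 'k::field poly \<Rightarrow> (nat \<Rightarrow> 'k) \<Rightarrow> 'k" where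
  "hom_eval d p v = (\<Sum>j\<le>d. coeff p j * (v 0 ^ (d - j) * v 1 ^ j))"

definition vec2 :: "'k::field \<Rightarrow> 'k \<Rightarrow> nat \<Rightarrow> 'k" where
  "vec2 s t i = (if i = 0 then s else if i = 1 then t else 0)"

lemma vec2_simps [simp]: "vec2 s t 0 = s" "vec2 s t (Suc 0) = t"
  by (auto simp: vec2_def)

lemma nonzero_vec2 [simp]: "nonzero_vec 1 (vec2 s t) \<longleftrightarrow> s \<noteq> 0 \<or> t \<noteq> 0"
  unfolding nonzero_vec_def vec2_def
  by (auto intro: exI[of _ 0] exI[of _ 1])

declare nonzero_vec2 [unfolded One_nat_def, simp]

lemma nonzero_vec_1_eq: "nonzero_vec 1 v \<Longrightarrow> v = vec2 (v 0) (v 1)"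
  by (rule ext) (auto simp: nonzero_vec_def vec2_def)

lemma vec2_scale: "vec2 (c * s) (c * t) = (\<lambda>i. c * vec2 s t i)"
  by (rule ext) (auto simp: vec2_def)

lemma form_hom_eval: "form 1 d (hom_eval d p)"
proof -
  have "form 1 d (\<lambda>v::nat \<Rightarrow> 'a. v 0 ^ (d - j) * v 1 ^ j)" if "j \<le> d" for j
    using form_mult[OF form_power[OF form_coord[of 0 1], of "d - j"] form_power[OF form_coord[of 1 1], of j]]
      that by simp
  then have "form 1 d (\<lambda>v. \<Sum>j\<le>d. coeff p j * (v 0 ^ (d - j) * v 1 ^ j))"
    by (intro form_sum form_cmult) auto
  then show ?thesis
    unfolding hom_eval_def [abs_def] .
qed

lemma hom_eval_0 [simp]: "hom_eval d 0 v = 0"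
  by (simp add: hom_eval_def)

lemma hom_eval_add: "hom_eval d (p + q) v = hom_eval d p v + hom_eval d q v"
  by (simp add: hom_eval_def sum.distrib distrib_right)

lemma hom_eval_smult: "hom_eval d (smult a p) v = a * hom_eval d p v"
  by (simp add: hom_eval_def sum_distrib_left mult.assoc)

lemma hom_eval_sum: "hom_eval d (\<Sum>i\<in>I. p i) v = (\<Sum>i\<in>I. hom_eval d (p i) v)"
  by (induction I rule: infinite_finite_induct) (auto simp: hom_eval_add)

lemma hom_eval_affine:
  assumes "degree p \<le> d" "v 0 \<noteq> 0"
  shows "hom_eval d p v = v 0 ^ d * poly p (v 1 / v 0)"
proof -
  have "poly p (v 1 / v 0) = (\<Sum>j\<le>d. coeff p j * (v 1 / v 0) ^ j)"
    unfolding poly_altdef using assms(1)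
    by (intro sum.mono_neutral_left) (auto simp: coeff_eq_0)
  moreover have "v 0 ^ d * (v 1 / v 0) ^ j = v 0 ^ (d - j) * v 1 ^ j" if "j \<le> d" for j
    using assms(2) that by (simp add: power_divide power_diff)
  ultimately show ?thesis
    unfolding hom_eval_def by (simp add: sum_distrib_left mult.left_commute[of "v 0 ^ d"])
qed

lemma hom_eval_infinity:
  assumes "v 0 = 0"
  shows "hom_eval d p v = coeff p d * v 1 ^ d"
proof -
  have "hom_eval d p v = (\<Sum>j\<in>{d}. coeff p j * (v 0 ^ (d - j) * v 1 ^ j))"
    unfolding hom_eval_def using assms by (intro sum.mono_neutral_right) auto
  then show ?thesis
    by simp
qed

lemma coeff_mult_le:
  assumes "degree p \<le> m" "degree q \<le> n"
  shows "coeff (p * q) (m + n) = coeff p m * coeff q n"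
proof (cases "degree p = m \<and> degree q = n")
  case True
  then show ?thesis
    using coeff_mult_degree_sum[of p q] by auto
next
  case False
  then have "degree p + degree q < m + n"
    using assms by linarith
  then have "degree (p * q) < m + n"
    using degree_mult_le[of p q] by linarith
  then show ?thesis
    using False assms by (auto simp: coeff_eq_0 le_less)
qed

lemma hom_eval_mult:
  assumes "degree p \<le> d" "degree q \<le> e"
  shows "hom_eval (d + e) (p * q) v = hom_eval d p v * hom_eval e q v"
proof (cases "v 0 = 0")
  case True
  then show ?thesis
    by (simp add: hom_eval_infinity coeff_mult_le[OF assms] power_add)
next
  case False
  have "degree (p * q) \<le> d + e"
    using degree_mult_le[of p q] assms by linarith
  then show ?thesis
    using False assms by (simp add: hom_eval_affine power_add)
qed

lemma hom_eval_power:
  assumes "degree p \<le> d"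
  shows "hom_eval (k * d) (p ^ k) v = hom_eval d p v ^ k"
proof (induction k)
  case 0
  then show ?case
    by (simp add: hom_eval_def)
next
  case (Suc k)
  have "degree (p ^ k) \<le> k * d"
    using degree_power_le[of p k] assms by (metis mult.commute mult_le_mono1 order_trans)
  from hom_eval_mult[OF assms this] Suc show ?case
    by simp
qed

lemma hom_eval_one: "hom_eval d 1 v = v 0 ^ d"
proof -
  have "hom_eval d 1 v = (\<Sum>j\<in>{0}. coeff 1 j * (v 0 ^ (d - j) * v 1 ^ j))"
    unfolding hom_eval_def by (intro sum.mono_neutral_right) auto
  then show ?thesis
    by simp
qed

lemma hom_eval_monom: "hom_eval d (monom 1 d) v = v 1 ^ d"
proof -
  have "hom_eval d (monom 1 d) v = (\<Sum>j\<in>{d}. coeff (monom 1 d) j * (v 0 ^ (d - j) * v 1 ^ j))"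
    unfolding hom_eval_def by (intro sum.mono_neutral_right) auto
  then show ?thesis
    by simp
qed

lemma hom_eval_uminus: "hom_eval d (- p) v = - hom_eval d p v"
  using hom_eval_smult[of d "-1" p v] by simp

lemma hom_eval_frobenius_sum:
  assumes "(\<Sum>i\<le>n. B i ^ q * F i) = 0"
    and "\<And>i. i \<le> n \<Longrightarrow> degree (B i) \<le> d" "\<And>i. i \<le> n \<Longrightarrow> degree (F i) \<le> e"
  shows "(\<Sum>i\<le>n. hom_eval d (B i) v ^ q * hom_eval e (F i) v) = 0"
proof -
  have "hom_eval (q * d + e) (B i ^ q * F i) v = hom_eval d (B i) v ^ q * hom_eval e (F i) v"
    if "i \<le> n" for i
  proof -
    have "degree (B i ^ q) \<le> q * d"
      using degree_power_le[of "B i" q] assms(2)[OF that]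
      by (metis mult.commute mult_le_mono1 order_trans)
    from hom_eval_mult[OF this assms(3)[OF that]] show ?thesis
      by (simp add: hom_eval_power[OF assms(2)[OF that]])
  qed
  then have "(\<Sum>i\<le>n. hom_eval d (B i) v ^ q * hom_eval e (F i) v) =
      hom_eval (q * d + e) (\<Sum>i\<le>n. B i ^ q * F i) v"
    by (simp add: hom_eval_sum)
  then show ?thesis
    unfolding assms(1) by simp
qed

lemma form_1_hom_eval:
  assumes "form 1 d P"
  obtains p where "degree p \<le> d" "P = hom_eval d p"
proof -
  obtain c where P: "P = (\<lambda>v. \<Sum>\<alpha>\<in>exponents 1 d. c \<alpha> * (\<Prod>i\<le>1. v i ^ \<alpha> i))"
    using assms unfolding form_def by blast
  define p where "p = (\<Sum>\<alpha>\<in>exponents 1 d. monom (c \<alpha>) (\<alpha> 1))"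
  have le: "\<alpha> 1 \<le> d" and eq: "\<alpha> 0 = d - \<alpha> 1" if "\<alpha> \<in> exponents 1 d" for \<alpha>
    using that by (auto simp: exponents_def)
  have "degree p \<le> d"
    unfolding p_def using le by (intro degree_sum_le finite_exponents) (meson degree_monom_le order_trans)
  moreover have "hom_eval d (monom (c \<alpha>) (\<alpha> 1)) v = c \<alpha> * (\<Prod>i\<le>1. v i ^ \<alpha> i)"
    if "\<alpha> \<in> exponents 1 d" for \<alpha> v
  proof -
    have "hom_eval d (monom (c \<alpha>) (\<alpha> 1)) v =
        (\<Sum>j\<in>{\<alpha> 1}. c \<alpha> * (v 0 ^ (d - j) * v 1 ^ j))"
      unfolding hom_eval_def using le[OF that]
      by (intro sum.mono_neutral_cong_right) auto
    then show ?thesis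
      using eq[OF that] by simp
  qed
  then have "P = hom_eval d p"
    unfolding P p_def hom_eval_sum by (intro ext sum.cong) auto
  ultimately show ?thesis
    using that by blast
qed

definition rational_at :: "int \<Rightarrow> (nat \<Rightarrow> 'k::field) \<Rightarrow> ((nat \<Rightarrow> 'k) \<Rightarrow> 'k) \<Rightarrow> bool" where
  "rational_at a v \<sigma> \<longleftrightarrow> (\<exists>d e P Q. form 1 d P \<and> form 1 e Q \<and> int d - int e = a \<and> Q v \<noteq> 0 \<and>
    (\<forall>z. nonzero_vec 1 z \<longrightarrow> Q z \<noteq> 0 \<longrightarrow> \<sigma> z = P z / Q z))"

lemma rational_atI:
  assumes "form 1 d P" "form 1 e Q" "int d - int e = a" "Q v \<noteq> 0"
    and "\<And>z. nonzero_vec 1 z \<Longrightarrow> Q z \<noteq> 0 \<Longrightarrow> \<sigma> z = P z / Q z"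
  shows "rational_at a v \<sigma>"
  using assms unfolding rational_at_def by blast

lemma rational_at_form: "form 1 d P \<Longrightarrow> rational_at (int d) v P"
  by (rule rational_atI[OF _ form_one]) auto

lemma rational_at_const: "rational_at 0 v (\<lambda>z. c)"
  using rational_at_form[OF form_const[of 1 c]] by simp

lemma rational_at_inverse: "form 1 d P \<Longrightarrow> P v \<noteq> 0 \<Longrightarrow> rational_at (- int d) v (\<lambda>z. 1 / P z)"
  by (rule rational_atI[OF form_one]) auto

lemma rational_at_add:
  assumes "rational_at a v \<sigma>" "rational_at a v \<tau>"
  shows "rational_at a v (\<lambda>z. \<sigma> z + \<tau> z)"
proof -
  obtain d e P Q where 1: "form 1 d P" "form 1 e Q" "int d - int e = a" "Q v \<noteq> 0"
    "\<And>z. nonzero_vec 1 z \<Longrightarrow> Q z \<noteq> 0 \<Longrightarrow> \<sigma> z = P z / Q z"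
    using assms(1) unfolding rational_at_def by metis
  obtain d' e' R S where 2: "form 1 d' R" "form 1 e' S" "int d' - int e' = a" "S v \<noteq> 0"
    "\<And>z. nonzero_vec 1 z \<Longrightarrow> S z \<noteq> 0 \<Longrightarrow> \<tau> z = R z / S z"
    using assms(2) unfolding rational_at_def by metis
  have "e + d' = d + e'"
    using 1 2 by linarith
  then have "form 1 (d + e') (\<lambda>z. P z * S z + Q z * R z)"
    using form_mult[OF 1(1) 2(2)] form_mult[OF 1(2) 2(1)] by (intro form_add) auto
  from rational_atI[OF this form_mult[OF 1(2) 2(2)], of a v] show ?thesis
    using 1 2 by (simp add: add_frac_eq)
qed

lemma rational_at_mult:
  assumes "rational_at a v \<sigma>" "rational_at b v \<tau>"
  shows "rational_at (a + b) v (\<lambda>z. \<sigma> z * \<tau> z)"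
proof -
  obtain d e P Q where 1: "form 1 d P" "form 1 e Q" "int d - int e = a" "Q v \<noteq> 0"
    "\<And>z. nonzero_vec 1 z \<Longrightarrow> Q z \<noteq> 0 \<Longrightarrow> \<sigma> z = P z / Q z"
    using assms(1) unfolding rational_at_def by metis
  obtain d' e' R S where 2: "form 1 d' R" "form 1 e' S" "int d' - int e' = b" "S v \<noteq> 0"
    "\<And>z. nonzero_vec 1 z \<Longrightarrow> S z \<noteq> 0 \<Longrightarrow> \<tau> z = R z / S z"
    using assms(2) unfolding rational_at_def by metis
  from rational_atI[OF form_mult[OF 1(1) 2(1)] form_mult[OF 1(2) 2(2)], of "a + b" v]
  show ?thesis
    using 1 2 by simp
qed

text \<open>For negative \<open>a\<close> even the zero section needs a denominator of positive
  degree; a power of a coordinate nonzero at \<open>v\<close> provides it.\<close>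

lemma rational_at_zero:
  assumes "nonzero_vec 1 v"
  shows "rational_at a v (\<lambda>z. 0)"
proof -
  obtain j where j: "j \<le> 1" "v j \<noteq> 0"
    using assms by (auto simp: nonzero_vec_def)
  show ?thesis
  proof (rule rational_atI[OF form_zero[of 1 "nat a"] form_power[OF form_coord[OF j(1)]]])
    show "int (nat a) - int (nat (- a) * 1) = a"
      by simp
  qed (use j in auto)
qed

lemma rational_at_sum:
  assumes "nonzero_vec 1 v" "\<And>i. i \<in> I \<Longrightarrow> rational_at a v (\<sigma> i)"
  shows "rational_at a v (\<lambda>z. \<Sum>i\<in>I. \<sigma> i z)"
  using assms(2)
proof (induction I rule: infinite_finite_induct)
  case (insert i I)
  then have "rational_at a v (\<lambda>z. \<sigma> i z + (\<Sum>i\<in>I. \<sigma> i z))"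
    by (intro rational_at_add) auto
  with insert.hyps show ?case
    by simp
qed (simp_all add: rational_at_zero[OF assms(1)])

lemma rational_at_power:
  assumes "rational_at a v \<sigma>"
  shows "rational_at (int k * a) v (\<lambda>z. \<sigma> z ^ k)"
proof (induction k)
  case (Suc k)
  from rational_at_mult[OF assms Suc] show ?case
    by (simp add: distrib_right)
qed (simp add: rational_at_const)

lemma rational_at_local:
  assumes "rational_at a v \<tau>" and R: "form 1 k R" "R v \<noteq> 0"
    and eq: "\<And>z. nonzero_vec 1 z \<Longrightarrow> R z \<noteq> 0 \<Longrightarrow> \<sigma> z = \<tau> z"
  shows "rational_at a v \<sigma>"
proof -
  obtain d e P Q where 1: "form 1 d P" "form 1 e Q" "int d - int e = a" "Q v \<noteq> 0"
    "\<And>z. nonzero_vec 1 z \<Longrightarrow> Q z \<noteq> 0 \<Longrightarrow> \<tau> z = P z / Q z"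
    using assms(1) unfolding rational_at_def by metis
  from rational_atI[OF form_mult[OF 1(1) R(1)] form_mult[OF 1(2) R(1)], of a v] show ?thesis
    using 1 R eq by simp
qed

lemma regular_at_imp_rational_at:
  assumes "regular_at 1 P1 x g" "v \<in> x"
  shows "rational_at 0 v (\<lambda>z. g (punctured_line z))"
proof -
  obtain d P Q where PQ: "fraction_at 1 P1 x g d P Q"
    using assms(1) regular_at_iff_fraction by blast
  show ?thesis
  proof (rule rational_atI[of d P d Q])
    show "g (punctured_line z) = P z / Q z" if "nonzero_vec 1 z" "Q z \<noteq> 0" for z
      using PQ that punctured_line_self[of z] punctured_line_in_proj[OF that(1)]
      by (simp add: fraction_at_def)
  qed (use PQ assms(2) in \<open>auto simp: fraction_at_def\<close>)
qed

lemma rational_at_homogeneous: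
  assumes "rational_at a v \<sigma>" "nonzero_vec 1 v" "c \<noteq> 0"
  shows "\<sigma> (\<lambda>i. c * v i) = c powi a * \<sigma> v"
proof -
  obtain d e P Q where 1: "form 1 d P" "form 1 e Q" "int d - int e = a" "Q v \<noteq> 0"
    "\<And>z. nonzero_vec 1 z \<Longrightarrow> Q z \<noteq> 0 \<Longrightarrow> \<sigma> z = P z / Q z"
    using assms(1) unfolding rational_at_def by metis
  have "nonzero_vec 1 (\<lambda>i. c * v i)"
    using assms(2,3) by (auto simp: nonzero_vec_def)
  then have "\<sigma> (\<lambda>i. c * v i) = c ^ d * P v / (c ^ e * Q v)"
    using 1 assms(3) form_homogeneous[OF 1(1)] form_homogeneous[OF 1(2)] by simp
  also have "\<dots> = c ^ d / c ^ e * \<sigma> v"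
    using 1 assms(2) by simp
  also have "c ^ d / c ^ e = c powi a"
    using assms(3) 1(3) by (simp add: power_int_diff flip: 1(3))
  finally show ?thesis .
qed

lemma rational_at_affine:
  assumes "rational_at a v \<sigma>"
  obtains d e p q where "degree p \<le> d" "degree q \<le> e" "int d - int e = a" "hom_eval e q v \<noteq> 0"
    "\<And>z. nonzero_vec 1 z \<Longrightarrow> hom_eval e q z \<noteq> 0 \<Longrightarrow> \<sigma> z = hom_eval d p z / hom_eval e q z"
    "\<And>t. poly q t \<noteq> 0 \<Longrightarrow> \<sigma> (vec2 1 t) = poly p t / poly q t"
proof -
  obtain d e P Q where 1: "form 1 d P" "form 1 e Q" "int d - int e = a" "Q v \<noteq> 0"
    "\<And>z. nonzero_vec 1 z \<Longrightarrow> Q z \<noteq> 0 \<Longrightarrow> \<sigma> z = P z / Q z"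
    using assms(1) unfolding rational_at_def by metis
  obtain p where p: "degree p \<le> d" "P = hom_eval d p"
    using form_1_hom_eval[OF 1(1)] .
  obtain q where q: "degree q \<le> e" "Q = hom_eval e q"
    using form_1_hom_eval[OF 1(2)] .
  have "\<sigma> (vec2 1 t) = poly p t / poly q t" if "poly q t \<noteq> 0" for t
    using 1(5)[of "vec2 1 t"] that p q by (simp add: hom_eval_affine)
  then show ?thesis
    using that[of p d q e] p q 1 by blast
qed

text \<open>
  The fraction representing \<open>\<sigma>\<close> on the affine chart, chosen with denominator of least degree, has a
  constant denominator: at a root of the denominator, comparison with a fraction regular there
  would allow to cancel a linear factor.
\<close>

lemma global_section_form:
  fixes \<sigma> :: "(nat \<Rightarrow> 'k::alg_closed_field) \<Rightarrow> 'k"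
  assumes reg: "\<And>v. nonzero_vec 1 v \<Longrightarrow> rational_at a v \<sigma>"
  obtains f where "f = 0 \<or> int (degree f) \<le> a"
    "\<And>v. nonzero_vec 1 v \<Longrightarrow> \<sigma> v = hom_eval (nat a) f v"
proof -
  \<comment> \<open>Starting from a fraction regular at infinity forces \<open>q\<close> to have
    full degree \<open>e\<close>; the bound on \<open>degree f\<close> comes from this.\<close>
  obtain d e p q where pq: "degree p \<le> d" "degree q \<le> e" "int d - int e = a"
    "hom_eval e q (vec2 0 1) \<noteq> 0"
    "\<And>z. nonzero_vec 1 z \<Longrightarrow> hom_eval e q z \<noteq> 0 \<Longrightarrow> \<sigma> z = hom_eval d p z / hom_eval e q z"
    "\<And>t. poly q t \<noteq> 0 \<Longrightarrow> \<sigma> (vec2 1 t) = poly p t / poly q t"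
    using rational_at_affine[OF reg[of "vec2 0 1"]] by (metis nonzero_vec2 zero_neq_one)
  have qe: "coeff q e \<noteq> 0"
    using pq(4) by (simp add: hom_eval_infinity)
  then have dq: "degree q = e" and q0: "q \<noteq> 0"
    using pq(2) le_degree by (auto intro: antisym)
  have local: "\<exists>p' q'. poly q' t \<noteq> 0 \<and> p * q' = p' * q \<and> \<sigma> (vec2 1 t) = poly p' t / poly q' t" for t
  proof -
    obtain d' e' p' q' where 2: "degree p' \<le> d'" "degree q' \<le> e'" "int d' - int e' = a"
      "hom_eval e' q' (vec2 1 t) \<noteq> 0"
      "\<And>t. poly q' t \<noteq> 0 \<Longrightarrow> \<sigma> (vec2 1 t) = poly p' t / poly q' t"
      using rational_at_affine[OF reg[of "vec2 1 t"]] by (metis nonzero_vec2 zero_neq_one)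
    have q't: "poly q' t \<noteq> 0"
      using 2(4) by (simp add: hom_eval_affine[OF 2(2)])
    have "(p * q' - p' * q) * (q * q') = 0"
    proof (rule poly_eq_0_if_vanishing)
      fix s
      show "poly ((p * q' - p' * q) * (q * q')) s = 0"
      proof (cases "poly q s = 0 \<or> poly q' s = 0")
        case False
        then have "poly p s / poly q s = poly p' s / poly q' s"
          using 2(5)[of s] pq(6)[of s] by auto
        then show ?thesis
          using False by (simp add: frac_eq_eq)
      qed auto
    qed
    then have "p * q' = p' * q"
      using q0 q't by auto
    then show ?thesis
      using 2(5)[OF q't] q't by blast
  qed
  \<comment> \<open>The possible denominators of the rational function \<open>p / q\<close>.\<close>
  define S where "S = {q'. q' \<noteq> 0 \<and> (\<exists>p'. p' * q = p * q')}"
  have "q \<in> S"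
    using q0 by (auto simp: S_def)
  then obtain q1 where q1: "q1 \<in> S" and min: "\<And>q'. q' \<in> S \<Longrightarrow> degree q1 \<le> degree q'"
    using ex_has_least_nat[of "\<lambda>q'. q' \<in> S" q degree] by blast
  then obtain p1 where p1: "p1 * q = p * q1" and q10: "q1 \<noteq> 0"
    by (auto simp: S_def)
  have "degree q1 = 0"
  proof (rule ccontr)
    assume "degree q1 \<noteq> 0"
    then obtain z where z: "poly q1 z = 0"
      using alg_closed_imp_poly_has_root[of q1] by auto
    obtain p' q' where 2: "poly q' z \<noteq> 0" "p * q' = p' * q"
      using local by blast
    have "q * (p1 * q') = p * q1 * q'"
      using p1 by (simp add: mult_ac)
    also have "\<dots> = q * (p' * q1)"
      using 2(2) by (simp add: mult_ac)
    finally have "p1 * q' = p' * q1"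
      using q0 by simp
    then have "poly p1 z * poly q' z = 0"
      using z by (metis mult_zero_right poly_mult)
    then have "poly p1 z = 0"
      using 2(1) by simp
    then obtain p2 where p2: "p1 = [:- z, 1:] * p2"
      by (auto simp: poly_eq_0_iff_dvd dvd_def)
    obtain q2 where q2: "q1 = [:- z, 1:] * q2"
      using z by (auto simp: poly_eq_0_iff_dvd dvd_def)
    have "[:- z, 1:] * (p2 * q) = [:- z, 1:] * (p * q2)"
      using p1 unfolding p2 q2 by (simp only: mult_ac)
    then have "p2 * q = p * q2"
      by (subst (asm) mult_cancel_left) auto
    moreover have "q2 \<noteq> 0"
      using q10 q2 by auto
    ultimately have "q2 \<in> S"
      by (auto simp: S_def)
    from min[OF this] show False
      unfolding q2 using \<open>q2 \<noteq> 0\<close> by (subst (asm) degree_mult_eq) auto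
  qed
  then obtain c where c: "q1 = [:c:]"
    by (metis degree_eq_zeroE)
  with q10 have c0: "c \<noteq> 0"
    by auto
  define f where "f = smult (1 / c) p1"
  have fq: "f * q = p"
    using p1 c c0 by (simp add: f_def)
  have f: "\<sigma> (vec2 1 t) = poly f t" for t
  proof -
    obtain p' q' where 2: "poly q' t \<noteq> 0" "p * q' = p' * q" "\<sigma> (vec2 1 t) = poly p' t / poly q' t"
      using local by blast
    have "q * (f * q') = q * p'"
      using 2(2) fq by (metis mult.assoc mult.commute)
    then have "p' = f * q'"
      using q0 by simp
    then show ?thesis
      using 2 by simp
  qed
  have df: "int (degree f) \<le> a" if "f \<noteq> 0"
  proof -
    have "degree f + e = degree p"
      using that q0 dq by (subst fq[symmetric], subst degree_mult_eq) auto
    then show ?thesis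
      using pq(1,3) by linarith
  qed
  have "\<sigma> v = hom_eval (nat a) f v" if v: "nonzero_vec 1 v" for v
  \<comment> \<open>For negative \<open>a\<close> the degree bound leaves only \<open>f = 0\<close>,
    and \<open>nat a\<close> is then a mere default.\<close>
  proof (cases "f = 0")
    case f0: True
    show ?thesis
    proof (cases "v 0 = 0")
      case True
      then have "v 1 \<noteq> 0"
        using nonzero_vec_1_eq[OF v] v by (metis nonzero_vec2)
      then have "hom_eval e q v \<noteq> 0"
        using True qe by (simp add: hom_eval_infinity)
      then show ?thesis
        using pq(5)[OF v] fq f0 by simp
    next
      case False
      have "v = (\<lambda>i. v 0 * vec2 1 (v 1 / v 0) i)"
        using nonzero_vec_1_eq[OF v] vec2_scale[of "v 0" 1 "v 1 / v 0"] False by simp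
      then have "\<sigma> v = v 0 powi a * \<sigma> (vec2 1 (v 1 / v 0))"
        using rational_at_homogeneous[OF reg, of "vec2 1 (v 1 / v 0)" "v 0"] False by simp
      then show ?thesis
        using f f0 by simp
    qed
  next
    case f0: False
    define b where "b = nat a"
    have b: "a = int b" and dfb: "degree f \<le> b"
      using df[OF f0] by (auto simp: b_def)
    have d: "d = b + e"
      using pq(3) b by simp
    show ?thesis
    proof (cases "v 0 = 0")
      case True
      then have v1: "v 1 \<noteq> 0"
        using nonzero_vec_1_eq[OF v] v by (metis nonzero_vec2)
      then have nz: "hom_eval e q v \<noteq> 0"
        using True qe by (simp add: hom_eval_infinity)
      have "coeff p d = coeff f b * coeff q e"
        unfolding fq[symmetric] d using dfb pq(2) by (rule coeff_mult_le)
      then show ?thesis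
        using pq(5)[OF v nz] True qe v1 by (simp add: hom_eval_infinity b d power_add)
    next
      case False
      have "v = (\<lambda>i. v 0 * vec2 1 (v 1 / v 0) i)"
        using nonzero_vec_1_eq[OF v] vec2_scale[of "v 0" 1 "v 1 / v 0"] False by simp
      then have "\<sigma> v = v 0 powi a * \<sigma> (vec2 1 (v 1 / v 0))"
        using rational_at_homogeneous[OF reg, of "vec2 1 (v 1 / v 0)" "v 0"] False by simp
      then show ?thesis
        using f dfb False by (simp add: hom_eval_affine b)
    qed
  qed
  then show ?thesis
    using that df by blast
qed

subsection \<open>Syzygies and Frobenius\<close>

text \<open>The smaller system still has a nonzero solution avoiding any chosen unknown. This yields
  independent solutions \<open>x\<close> and \<open>y\<close>, told apart by an unknown
  \<open>k\<close> with \<open>x k \<noteq> 0\<close> and \<open>y k = 0\<close>; some nonzero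
  combination satisfies the additional equation too.\<close>

lemma homogeneous_system_solution:
  fixes A :: "'r \<Rightarrow> 'c \<Rightarrow> 'k::field"
  assumes "finite I" "finite J" "card I < card J"
  shows "\<exists>x. (\<exists>j. x j \<noteq> 0) \<and> (\<forall>j. j \<notin> J \<longrightarrow> x j = 0) \<and> (\<forall>i\<in>I. (\<Sum>j\<in>J. A i j * x j) = 0)"
  using assms
proof (induction I arbitrary: J rule: finite_induct)
  case empty
  then obtain j where "j \<in> J"
    by fastforce
  then show ?case
    by (intro exI[of _ "\<lambda>i. if i = j then 1 else 0"]) auto
next
  case (insert i I)
  have sub: "\<exists>x. (\<exists>j. x j \<noteq> 0) \<and> x k = 0 \<and> (\<forall>j. j \<notin> J \<longrightarrow> x j = 0) \<and>
      (\<forall>i\<in>I. (\<Sum>j\<in>J. A i j * x j) = 0)" if "k \<in> J" for k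
  proof -
    have "card I < card (J - {k})"
      using insert.prems insert.hyps that by simp
    from insert.IH[OF _ this] insert.prems obtain x where x: "\<exists>j. x j \<noteq> 0"
      "\<forall>j. j \<notin> J - {k} \<longrightarrow> x j = 0" "\<forall>i\<in>I. (\<Sum>j\<in>J - {k}. A i j * x j) = 0"
      by auto
    then show ?thesis
      using that insert.prems by (intro exI[of _ x]) (auto simp: sum.remove[of J k])
  qed
  obtain j0 where "j0 \<in> J"
    using insert.prems by fastforce
  from sub[OF this] obtain x k where x: "x k \<noteq> 0" "\<forall>j. j \<notin> J \<longrightarrow> x j = 0"
      "\<forall>i\<in>I. (\<Sum>j\<in>J. A i j * x j) = 0"
    by auto
  then have "k \<in> J"
    by auto
  from sub[OF this] obtain y where y: "\<exists>j. y j \<noteq> 0" "y k = 0" "\<forall>j. j \<notin> J \<longrightarrow> y j = 0"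
      "\<forall>i\<in>I. (\<Sum>j\<in>J. A i j * y j) = 0"
    by auto
  define r where "r z = (\<Sum>j\<in>J. A i j * z j)" for z
  show ?case
  proof (cases "r y = 0")
    case True
    then show ?thesis
      using y by (intro exI[of _ y]) (auto simp: r_def)
  next
    case False
    define z where "z j = x j - r x / r y * y j" for j
    have lin: "(\<Sum>j\<in>J. A i' j * z j) =
        (\<Sum>j\<in>J. A i' j * x j) - r x / r y * (\<Sum>j\<in>J. A i' j * y j)" for i'
      unfolding z_def by (simp add: algebra_simps sum_subtractf sum_distrib_left)
    have "(\<Sum>j\<in>J. A i j * z j) = 0"
      using False unfolding lin r_def by simp
    moreover have "z k \<noteq> 0"
      using x y by (simp add: z_def)
    ultimately show ?thesis
      using x y lin by (intro exI[of _ z]) (auto simp: z_def)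
  qed
qed

text \<open>There is one linear equation for each \<open>i\<close> and each \<beta> in the gap, and
  the unknowns are the coefficients of \<Lambda> in \<open>J\<close>. Keeping \<open>J\<close>
  arbitrary later allows a solution with one coefficient prescribed to be zero.\<close>

lemma gap_multiplier_exists:
  fixes F :: "nat \<Rightarrow> 'k::field poly"
  assumes "finite J" "(n + 1) * m < card J"
  obtains \<Lambda> where "\<Lambda> \<noteq> 0" "\<And>j. j \<notin> J \<Longrightarrow> coeff \<Lambda> j = 0"
    "\<And>i \<beta>. i \<le> n \<Longrightarrow> e \<le> \<beta> \<Longrightarrow> \<beta> < e + m \<Longrightarrow> coeff (F i * \<Lambda>) \<beta> = 0"
proof -
  have "card ({..n} \<times> {e..<e + m}) < card J"
    using assms(2) by (simp add: card_cartesian_product)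
  from homogeneous_system_solution[OF _ assms(1) this,
      of "\<lambda>(i, \<beta>) j. coeff (F i * monom 1 j) \<beta>"]
  obtain x where x: "\<exists>j. x j \<noteq> 0" "\<forall>j. j \<notin> J \<longrightarrow> x j = 0"
    "\<And>i \<beta>. i \<le> n \<Longrightarrow> e \<le> \<beta> \<Longrightarrow> \<beta> < e + m \<Longrightarrow> (\<Sum>j\<in>J. coeff (F i * monom 1 j) \<beta> * x j) = 0"
    by force
  define \<Lambda> where "\<Lambda> = (\<Sum>j\<in>J. smult (x j) (monom 1 j))"
  have c: "coeff \<Lambda> j = x j" for j
  proof -
    have "coeff \<Lambda> j = (\<Sum>i\<in>J. if i = j then x i else 0)"
      unfolding \<Lambda>_def coeff_sum by (intro sum.cong) auto
    then show ?thesis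
      using assms(1) x(2) by auto
  qed
  show ?thesis
  proof (rule that[of \<Lambda>])
    show "\<Lambda> \<noteq> 0"
      using x(1) c by auto
    show "coeff \<Lambda> j = 0" if "j \<notin> J" for j
      using that c x(2) by simp
    show "coeff (F i * \<Lambda>) \<beta> = 0" if "i \<le> n" "e \<le> \<beta>" "\<beta> < e + m" for i \<beta>
      using x(3)[OF that] by (simp add: \<Lambda>_def sum_distrib_left coeff_sum mult.commute)
  qed
qed

lemma poly_cutoff_add: "poly_cutoff n (p + q) = poly_cutoff n p + poly_cutoff n q"
  by (rule poly_eqI) (simp add: coeff_poly_cutoff)

lemma poly_cutoff_smult: "poly_cutoff n (smult c p) = smult c (poly_cutoff n p)"
  by (rule poly_eqI) (simp add: coeff_poly_cutoff)

lemma smult_sum_right: "smult c (\<Sum>i\<in>I. p i) = (\<Sum>i\<in>I. smult c (p i))"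
  by (induction I rule: infinite_finite_induct) (auto simp: smult_add_right)

text \<open>
  For \<open>e = (m + 1) q\<close> degrees alone only give that \<open>\<Sum> (B i)^q * F i\<close> is a multiple of
  \<open>X^((e + m) q)\<close>. The factor is Frobenius-semilinear in \<open>\<Lambda>\<close>, so it vanishes for some nonzero
  combination of two independent solutions.
\<close>

lemma frobenius_syzygy:
  fixes F :: "nat \<Rightarrow> 'k::alg_closed_field poly"
  assumes char: "CHAR('k) > 0" and q: "q = CHAR('k) ^ r"
    and degF: "\<And>i. i \<le> q + 1 \<Longrightarrow> degree (F i) \<le> e"
    and fermat: "(\<Sum>i\<le>q + 1. F i ^ (q + 1)) = 0"
    and e: "m * (q + 1) < e" "e \<le> (m + 1) * q" and m: "m + 2 \<le> q"
  obtains \<Lambda> B C where "\<Lambda> \<noteq> 0" "degree \<Lambda> < e + m"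
    "\<And>i. i \<le> q + 1 \<Longrightarrow> F i * \<Lambda> = B i + monom 1 (e + m) * C i"
    "\<And>i. i \<le> q + 1 \<Longrightarrow> degree (B i) \<le> e - 1" "\<And>i. i \<le> q + 1 \<Longrightarrow> degree (C i) \<le> e - 1"
    "(\<Sum>i\<le>q + 1. B i ^ q * F i) = 0" "(\<Sum>i\<le>q + 1. C i ^ q * F i) = 0"
proof -
  have prime: "prime CHAR('k)"
    using char by (rule prime_CHAR_semidom)
  have frob: "(x + y) ^ q = x ^ q + y ^ q" for x y :: "'k poly"
    by (rule freshmans_dream') (use prime q in simp_all)
  have frob_k: "(x + y) ^ q = x ^ q + y ^ q" for x y :: 'k
    by (rule freshmans_dream') (use prime q in simp_all)
  have q0: "q > 0"
    using m by simp
  have e0: "e > 0"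
    using e by simp
  define good where "good \<Lambda> \<longleftrightarrow> (\<forall>j\<ge>e + m. coeff \<Lambda> j = 0) \<and>
    (\<forall>i\<le>q + 1. \<forall>\<beta>. e \<le> \<beta> \<and> \<beta> < e + m \<longrightarrow> coeff (F i * \<Lambda>) \<beta> = 0)" for \<Lambda>
  define S where "S \<Lambda> = (\<Sum>i\<le>q + 1. poly_cutoff e (F i * \<Lambda>) ^ q * F i)" for \<Lambda>
  \<comment> \<open>For a good \<Lambda> this is the only coefficient of \<open>S \<Lambda>\<close>
    not forced to vanish: lower ones are excluded by divisibility, higher ones by degree.\<close>
  define \<kappa> where "\<kappa> \<Lambda> = coeff (S \<Lambda>) ((e + m) * q)" for \<Lambda>
  have degB: "degree (poly_cutoff e (F i * \<Lambda>)) \<le> e - 1" for i \<Lambda>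
    using e0 by (intro degree_le) (auto simp: coeff_poly_cutoff)
  have degS: "degree (S \<Lambda>) \<le> (e - 1) * q + e" for \<Lambda>
    unfolding S_def
  proof (intro degree_sum_le)
    fix i assume i: "i \<in> {..q + 1}"
    have "degree (poly_cutoff e (F i * \<Lambda>) ^ q * F i) \<le>
        degree (poly_cutoff e (F i * \<Lambda>) ^ q) + degree (F i)"
      by (rule degree_mult_le)
    also have "\<dots> \<le> degree (poly_cutoff e (F i * \<Lambda>)) * q + e"
      using degree_power_le[of "poly_cutoff e (F i * \<Lambda>)" q] degF[of i] i by simp
    also have "\<dots> \<le> (e - 1) * q + e"
      using degB[of i \<Lambda>] by simp
    finally show "degree (poly_cutoff e (F i * \<Lambda>) ^ q * F i) \<le> (e - 1) * q + e" .
  qed simp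
  have eq_deg: "(e - 1) * q + q = e * q"
    using e0 by (cases e) auto
  then have deg_le: "(e - 1) * q + e \<le> (e + m) * q"
    using e(2) by (simp add: algebra_simps)
  obtain \<Lambda> where \<Lambda>: "\<Lambda> \<noteq> 0" "good \<Lambda>" "\<kappa> \<Lambda> = 0"
  proof -
    \<comment> \<open>This is \<open>m * (q + 1) < e\<close> with \<open>m\<close> added on both
      sides.\<close>
    have "(q + 1 + 1) * m < card {..<e + m}"
      using e(1) by (simp add: algebra_simps)
    then obtain \<Lambda>\<^sub>1 where \<Lambda>\<^sub>1': "\<Lambda>\<^sub>1 \<noteq> 0" "\<And>j. j \<notin> {..<e + m} \<Longrightarrow> coeff \<Lambda>\<^sub>1 j = 0"
        "\<And>i \<beta>. i \<le> q + 1 \<Longrightarrow> e \<le> \<beta> \<Longrightarrow> \<beta> < e + m \<Longrightarrow> coeff (F i * \<Lambda>\<^sub>1) \<beta> = 0"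
      using gap_multiplier_exists[where J = "{..<e + m}" and n = "q + 1" and m = m and F = F and e = e] by auto
    then have \<Lambda>\<^sub>1: "\<Lambda>\<^sub>1 \<noteq> 0" "good \<Lambda>\<^sub>1"
      by (auto simp: good_def)
    show ?thesis
    proof (cases "e = (m + 1) * q")
      case False
      then have "(e - 1) * q + e < (e + m) * q"
        using e(2) eq_deg by (simp add: algebra_simps)
      then have "\<kappa> \<Lambda>\<^sub>1 = 0"
        unfolding \<kappa>_def using degS[of \<Lambda>\<^sub>1] by (intro coeff_eq_0) simp
      then show ?thesis
        using that \<Lambda>\<^sub>1 by blast
    next
      case True
      obtain k where k: "coeff \<Lambda>\<^sub>1 k \<noteq> 0"
        using \<Lambda>\<^sub>1(1) by (metis leading_coeff_0_iff)
      then have "k < e + m"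
        using \<Lambda>\<^sub>1(2) by (auto simp: good_def not_le[symmetric])
      \<comment> \<open>With \<open>e = (m + 1) * q\<close> this amounts to
        \<open>m + 2 \<le> q\<close>. Dropping the unknown \<open>k\<close> makes the second
        solution independent of the first.\<close>
      then have "(q + 1 + 1) * m < card ({..<e + m} - {k})"
        using True m by (simp add: algebra_simps)
      then obtain \<Lambda>\<^sub>2 where \<Lambda>\<^sub>2': "\<Lambda>\<^sub>2 \<noteq> 0" "\<And>j. j \<notin> {..<e + m} - {k} \<Longrightarrow> coeff \<Lambda>\<^sub>2 j = 0"
          "\<And>i \<beta>. i \<le> q + 1 \<Longrightarrow> e \<le> \<beta> \<Longrightarrow> \<beta> < e + m \<Longrightarrow> coeff (F i * \<Lambda>\<^sub>2) \<beta> = 0"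
        using gap_multiplier_exists[where J = "{..<e + m} - {k}" and n = "q + 1" and m = m and F = F and e = e] by auto
      then have \<Lambda>\<^sub>2: "\<Lambda>\<^sub>2 \<noteq> 0" "good \<Lambda>\<^sub>2" "coeff \<Lambda>\<^sub>2 k = 0"
        by (auto simp: good_def)
      show ?thesis
      proof (cases "\<kappa> \<Lambda>\<^sub>2 = 0")
        case True
        then show ?thesis
          using that \<Lambda>\<^sub>2 by blast
      next
        case False
        obtain c where c: "c ^ q = - \<kappa> \<Lambda>\<^sub>1 / \<kappa> \<Lambda>\<^sub>2"
          using nth_root_exists[OF q0] by blast
        have "S (\<Lambda>\<^sub>1 + smult c \<Lambda>\<^sub>2) = S \<Lambda>\<^sub>1 + smult (c ^ q) (S \<Lambda>\<^sub>2)"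
          unfolding S_def
          by (simp add: distrib_left poly_cutoff_add poly_cutoff_smult frob distrib_right
              sum.distrib smult_sum_right smult_add_right smult_power)
        then have "\<kappa> (\<Lambda>\<^sub>1 + smult c \<Lambda>\<^sub>2) = 0"
          using False c by (simp add: \<kappa>_def)
        moreover have "good (\<Lambda>\<^sub>1 + smult c \<Lambda>\<^sub>2)"
          using \<Lambda>\<^sub>1(2) \<Lambda>\<^sub>2(2) by (simp add: good_def distrib_left)
        moreover have "coeff (\<Lambda>\<^sub>1 + smult c \<Lambda>\<^sub>2) k \<noteq> 0"
          using k \<Lambda>\<^sub>2(3) by simp
        then have "\<Lambda>\<^sub>1 + smult c \<Lambda>\<^sub>2 \<noteq> 0"
          by force
        ultimately show ?thesis
          using that by blast
      qed
    qed
  qed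
  define B where "B i = poly_cutoff e (F i * \<Lambda>)" for i
  define C where "C i = poly_shift (e + m) (F i * \<Lambda>)" for i
  have deg\<Lambda>: "degree \<Lambda> < e + m"
    using \<Lambda>(1,2) unfolding good_def by (metis leading_coeff_0_iff not_le)
  have split: "F i * \<Lambda> = B i + monom 1 (e + m) * C i" if "i \<le> q + 1" for i
  proof (rule poly_eqI)
    fix \<beta>
    consider "\<beta> < e" | "e \<le> \<beta>" "\<beta> < e + m" | "e + m \<le> \<beta>"
      by linarith
    then show "coeff (F i * \<Lambda>) \<beta> = coeff (B i + monom 1 (e + m) * C i) \<beta>"
      by cases (use \<Lambda>(2) that in \<open>auto simp: B_def C_def coeff_poly_cutoff coeff_poly_shift
          coeff_monom_mult good_def\<close>)
  qed
  have degC: "degree (C i) \<le> e - 1" if "i \<le> q + 1" for i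
  proof (rule degree_le, intro allI impI)
    fix j assume "e - 1 < j"
    then have "degree (F i) + degree \<Lambda> < j + (e + m)"
      using degF[OF that] deg\<Lambda> by linarith
    then have "degree (F i * \<Lambda>) < j + (e + m)"
      using degree_mult_le[of "F i" \<Lambda>] by linarith
    then show "coeff (C i) j = 0"
      by (simp add: C_def coeff_poly_shift coeff_eq_0)
  qed
  define T where "T = (\<Sum>i\<le>q + 1. C i ^ q * F i)"
  \<comment> \<open>The \<open>q\<close>-th power of the splitting, multiplied by \<open>F i\<close>
    and summed; the right side is \<open>\<Lambda> ^ q\<close> times the Fermat equation along the
    curve, hence zero.\<close>
  have "S \<Lambda> + monom 1 ((e + m) * q) * T = (\<Sum>i\<le>q + 1. (F i * \<Lambda>) ^ q * F i)"
  proof -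
    have "(F i * \<Lambda>) ^ q * F i = B i ^ q * F i + monom 1 ((e + m) * q) * (C i ^ q * F i)"
      if "i \<le> q + 1" for i
      unfolding split[OF that] frob
      by (simp add: power_mult_distrib monom_power algebra_simps)
    then have "(\<Sum>i\<le>q + 1. (F i * \<Lambda>) ^ q * F i) =
        (\<Sum>i\<le>q + 1. B i ^ q * F i + monom 1 ((e + m) * q) * (C i ^ q * F i))"
      by (intro sum.cong) auto
    then show ?thesis
      unfolding S_def T_def B_def sum.distrib sum_distrib_left by simp
  qed
  also have "\<dots> = \<Lambda> ^ q * (\<Sum>i\<le>q + 1. F i ^ (q + 1))"
    unfolding sum_distrib_left by (intro sum.cong) (simp_all add: power_mult_distrib mult_ac)
  finally have ST: "S \<Lambda> + monom 1 ((e + m) * q) * T = 0"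
    unfolding fermat by simp
  have S0: "S \<Lambda> = 0"
  proof (rule poly_eqI)
    fix j
    consider "j < (e + m) * q" | "j = (e + m) * q" | "(e + m) * q < j"
      by linarith
    then show "coeff (S \<Lambda>) j = coeff 0 j"
    proof cases
      case 1
      then have "coeff (S \<Lambda> + monom 1 ((e + m) * q) * T) j = coeff (S \<Lambda>) j"
        by (simp add: coeff_monom_mult)
      then show ?thesis
        unfolding ST by simp
    next
      case 2
      then show ?thesis
        using \<Lambda>(3) by (simp add: \<kappa>_def)
    next
      case 3
      then show ?thesis
        using degS[of \<Lambda>] deg_le by (simp add: coeff_eq_0)
    qed
  qed
  then have "T = 0"
    using ST by simp
  show ?thesis
  proof (rule that)
    show "\<Lambda> \<noteq> 0" "degree \<Lambda> < e + m"
      using \<Lambda>(1) deg\<Lambda> by auto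
    show "F i * \<Lambda> = B i + monom 1 (e + m) * C i" if "i \<le> q + 1" for i
      using split that .
    show "degree (B i) \<le> e - 1" for i
      unfolding B_def by (rule degB)
    show "degree (C i) \<le> e - 1" if "i \<le> q + 1" for i
      using degC that .
    show "(\<Sum>i\<le>q + 1. B i ^ q * F i) = 0"
      using S0 unfolding S_def B_def .
    show "(\<Sum>i\<le>q + 1. C i ^ q * F i) = 0"
      using \<open>T = 0\<close> unfolding T_def .
  qed
qed

text \<open>Let \<open>g\<close> be the reduced denominator of \<open>B c / F c\<close>.
  Proportionality makes every \<open>F b\<close> a possible denominator, so division with remainder
  and minimality give that \<open>g\<close> divides all \<open>F b\<close>. These have no common
  zero, so \<open>g\<close> is constant, \<open>F c\<close> divides \<open>B c\<close>, and degrees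
  leave only zero.\<close>

lemma proportional_polys_vanish:
  fixes F B :: "nat \<Rightarrow> 'k::alg_closed_field poly"
  assumes cross: "\<And>a c. a \<le> n \<Longrightarrow> c \<le> n \<Longrightarrow> B a * F c = B c * F a"
    and nozero: "\<And>t. \<exists>a\<le>n. poly (F a) t \<noteq> 0"
    and c: "c \<le> n" "degree (B c) < degree (F c)"
    and a: "a \<le> n"
  shows "B a = 0"
proof -
  define S where "S = {g. g \<noteq> 0 \<and> F c dvd g * B c}"
  have Fc0: "F c \<noteq> 0"
    using c by auto
  then have "F c \<in> S"
    by (simp add: S_def)
  then obtain g where g: "g \<in> S" and min: "\<And>h. h \<in> S \<Longrightarrow> degree g \<le> degree h"
    using ex_has_least_nat[of "\<lambda>h. h \<in> S" "F c" degree] by blast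
  have "g dvd F b" if b: "b \<le> n" for b
  proof (rule ccontr)
    assume "\<not> g dvd F b"
    then have nz: "F b mod g \<noteq> 0"
      by (simp add: dvd_eq_mod_eq_0)
    have "F c dvd F b * B c - (F b div g) * (g * B c)"
      using cross[OF b c(1)] g by (auto simp: S_def mult.commute[of "F b"] simp flip: cross[OF b c(1)])
    also have "F b * B c - (F b div g) * (g * B c) = (F b mod g) * B c"
      by (simp add: minus_div_mult_eq_mod[symmetric] algebra_simps)
    finally have "F b mod g \<in> S"
      using nz by (simp add: S_def)
    from min[OF this] show False
      using degree_mod_less[of g "F b"] nz g by (auto simp: S_def)
  qed
  then have "poly g t \<noteq> 0" for t
    using nozero[of t] by (metis dvd_def mult_zero_left poly_mult)
  then have "degree g = 0"
    using alg_closed_imp_poly_has_root[of g] by blast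
  then have "g dvd 1"
    using g by (auto simp: S_def is_unit_iff_degree)
  then have "F c dvd B c"
    using g by (simp add: S_def dvd_mult_unit_iff'[OF \<open>g dvd 1\<close>])
  then have "B c = 0"
    using c(2) by (metis dvd_imp_degree_le not_le)
  then show ?thesis
    using cross[OF a c(1)] Fc0 by simp
qed

text \<open>The lowest nonzero coefficient of \<open>q\<close>, multiplied by
  \<open>poly p 0\<close>, is a coefficient of the product below \<open>n\<close>.\<close>

lemma eq_0_if_monom_dvd_mult:
  fixes p :: "'k::field poly"
  assumes "monom 1 n dvd p * q" "poly p 0 \<noteq> 0" "degree q < n"
  shows "q = 0"
proof (rule ccontr)
  assume "q \<noteq> 0"
  then have ex: "\<exists>k. coeff q k \<noteq> 0"
    by (metis leading_coeff_0_iff)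
  define k where "k = (LEAST k. coeff q k \<noteq> 0)"
  have k: "coeff q k \<noteq> 0"
    unfolding k_def using ex by (rule LeastI_ex)
  have below: "coeff q j = 0" if "j < k" for j
    using not_less_Least that unfolding k_def by blast
  have "k < n"
    using k assms(3) le_degree by fastforce
  obtain h where h: "p * q = monom 1 n * h"
    using assms(1) by (elim dvdE)
  have "coeff (p * q) k = (\<Sum>i\<le>k. coeff p i * coeff q (k - i))"
    by (rule coeff_mult)
  also have "\<dots> = (\<Sum>i\<in>{0}. coeff p i * coeff q (k - i))"
    using below by (intro sum.mono_neutral_right) auto
  finally have "coeff p 0 * coeff q k = 0"
    using \<open>k < n\<close> by (simp add: h coeff_monom_mult)
  then show False
    using k assms(2) by (simp add: poly_0_coeff_0)
qed

subsection \<open>The forms of a rational curve\<close>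

lemma punctured_line_closed:
  assumes "y \<in> proj n" "w \<in> y" "c \<noteq> 0"
  shows "(\<lambda>i. c * w i) \<in> y"
proof -
  have "y = punctured_line w"
    using proj_memD(1) assms by blast
  then show ?thesis
    using assms(3) by (auto simp: punctured_line_def)
qed

lemma proj_memE:
  assumes "y \<in> proj n" "w \<in> y" "z \<in> y"
  obtains c where "c \<noteq> 0" "z = (\<lambda>i. c * w i)"
proof -
  have "z \<in> punctured_line w"
    using proj_memD(1)[OF assms(1,2)] assms(3) by simp
  then show ?thesis
    using that by (auto simp: punctured_line_def)
qed

lemma regular_section_twisting_imp_rational_at:
  assumes "regular_section_at (twisting_bundle 1 P1 a) x s" "v \<in> x"
  shows "rational_at a v (\<lambda>z. s (punctured_line z) z)"
proof -
  obtain U d e P Q where U: "zopen 1 P1 U" "x \<in> U" and PQ: "form 1 d P" "form 1 e Q" "int d - int e = a"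
    and s: "\<And>y v. y \<in> U \<Longrightarrow> v \<in> y \<Longrightarrow> Q v \<noteq> 0 \<and> s y v = P v / Q v"
    using assms(1) by (auto simp: twisting_bundle_def)
  obtain k S where S: "form 1 k S" "\<forall>v\<in>x. S v \<noteq> 0"
    "\<And>y. y \<in> P1 \<Longrightarrow> \<forall>v\<in>y. S v \<noteq> 0 \<Longrightarrow> y \<in> U"
    using zopenE[OF U] by metis
  have "rational_at a v (\<lambda>z. P z / Q z)"
    by (rule rational_atI[OF PQ]) (use s U assms(2) in auto)
  then show ?thesis
  proof (rule rational_at_local[OF _ S(1)])
    show "S v \<noteq> 0"
      using S(2) assms(2) by blast
    fix z :: "nat \<Rightarrow> 'a"
    assume z: "nonzero_vec 1 z" "S z \<noteq> 0"
    have "punctured_line z \<in> U"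
      using form_nonzero_on_line[OF S(1) punctured_line_in_proj[OF z(1)] punctured_line_self _ z(2)]
      by (intro S(3) punctured_line_in_proj z) auto
    then show "s (punctured_line z) z = P z / Q z"
      using s punctured_line_self by blast
  qed
qed

lemma regular_section_twistingI:
  assumes "x \<in> X" "form n d P" "form n e Q" "int d - int e = a"
    and "\<And>y v. y \<in> X \<Longrightarrow> v \<in> y \<Longrightarrow> Q v \<noteq> 0 \<and> s y v = P v / Q v"
  shows "regular_section_at (twisting_bundle n X a) x s"
proof -
  have "\<exists>U d e P Q. zopen n X U \<and> x \<in> U \<and> form n d P \<and> form n e Q \<and> int d - int e = a \<and>
         (\<forall>y\<in>U. \<forall>v\<in>y. Q v \<noteq> 0 \<and> s y v = P v / Q v)"
    using assms zopen_whole by blast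
  then show ?thesis
    by (simp add: twisting_bundle_def)
qed

text \<open>The coordinates are sections of the line bundle of degree 1. Their pullbacks,
  transported to the bundle of degree \<open>e\<close> on the projective line, are global sections
  and therefore forms \<open>F i\<close>. Homogeneity on fibres preserves their ratios, and
  injectivity excludes a common zero.\<close>

lemma curve_degree_forms:
  fixes f :: "'k::alg_closed_field pt \<Rightarrow> 'k pt"
  assumes deg: "curve_degree n f e" and f: "\<And>x. x \<in> P1 \<Longrightarrow> f x \<in> proj n"
  obtains F where "\<And>i. i \<le> n \<Longrightarrow> F i = 0 \<or> int (degree (F i)) \<le> e"
    "\<And>v. nonzero_vec 1 v \<Longrightarrow>
      (\<lambda>i. if i \<le> n then hom_eval (nat e) (F i) v else 0) \<in> f (punctured_line v)"
proof -
  define L where "L = pullback 1 P1 (proj n) f (twisting_bundle n (proj n) 1)"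
  define M :: "('k, nat \<Rightarrow> 'k) vbundle" where "M = twisting_bundle 1 P1 e"
  have "bundle_iso P1 L M"
    using deg by (simp add: curve_degree_def line_bundle_degree_def L_def M_def)
  then obtain \<psi> where bij: "\<And>x. x \<in> P1 \<Longrightarrow> bij_betw (\<psi> x) (fibre L x) (fibre M x)"
    and scale: "\<And>x s a. x \<in> P1 \<Longrightarrow> s \<in> fibre L x \<Longrightarrow> \<psi> x (\<lambda>b. a * s b) = (\<lambda>c. a * \<psi> x s c)"
    and reg: "\<And>\<sigma> x. section_of P1 L \<sigma> \<Longrightarrow> x \<in> P1 \<Longrightarrow>
      regular_section_at L x \<sigma> \<longleftrightarrow> regular_section_at M x (\<lambda>y. \<psi> y (\<sigma> y))"
    unfolding bundle_iso_def by blast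
  have fibL: "fibre L x = {s. (\<forall>v\<in>f x. \<forall>c. c \<noteq> 0 \<longrightarrow> s (\<lambda>i. c * v i) = c * s v) \<and>
                     (\<forall>v. v \<notin> f x \<longrightarrow> s v = 0)}" for x
    by (simp add: L_def pullback_def twisting_bundle_def)
  define \<sigma> where "\<sigma> i y w = (if w \<in> f y then w i else 0)" for i y and w :: "nat \<Rightarrow> 'k"
  have sec: "\<sigma> i y \<in> fibre L y" if "y \<in> P1" for i y
    using punctured_line_closed[OF f[OF that]] by (auto simp: fibL \<sigma>_def)
  have regL: "regular_section_at L x (\<sigma> i)" if x: "x \<in> P1" and i: "i \<le> n" for x i
  proof -
    define \<tau> :: "nat \<Rightarrow> 'k pt \<Rightarrow> (nat \<Rightarrow> 'k) \<Rightarrow> 'k"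
      where "\<tau> j z w = (if w \<in> z then w i else 0)" for j z w
    have sec\<tau>: "section_of (proj n) (twisting_bundle n (proj n) 1) (\<tau> j)" for j
      using punctured_line_closed by (auto simp: section_of_def twisting_bundle_def \<tau>_def)
    have reg\<tau>: "regular_section_at (twisting_bundle n (proj n) 1) (f x) (\<tau> j)" for j
      by (rule regular_section_twistingI[OF f[OF x] form_coord[OF i] form_one])
        (auto simp: \<tau>_def)
    show ?thesis
      unfolding L_def pullback_def using sec\<tau> reg\<tau> zopen_whole x regular_at_const[OF order_refl x, of 1]
      by (auto intro!: exI[of _ "1::nat"] exI[of _ "\<lambda>_ _. 1"] exI[of _ \<tau>] exI[of _ P1]
          simp: \<sigma>_def \<tau>_def)
  qed
  define s where "s i v = \<psi> (punctured_line v) (\<sigma> i (punctured_line v)) v" for i v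
  have "rational_at e v (s i)" if v: "nonzero_vec 1 v" and i: "i \<le> n" for v i
  proof -
    have "regular_section_at M (punctured_line v) (\<lambda>y. \<psi> y (\<sigma> i y))"
      using reg[of "\<sigma> i"] sec regL[OF punctured_line_in_proj[OF v] i] punctured_line_in_proj[OF v]
      by (auto simp: section_of_def)
    then show ?thesis
      unfolding M_def s_def [abs_def]
      by (rule regular_section_twisting_imp_rational_at) (rule punctured_line_self)
  qed
  then have "\<exists>g. (g = 0 \<or> int (degree g) \<le> e) \<and>
      (\<forall>v. nonzero_vec 1 v \<longrightarrow> s i v = hom_eval (nat e) g v)" if "i \<le> n" for i
    using global_section_form[of e "s i"] that by metis
  then obtain F where F: "\<And>i. i \<le> n \<Longrightarrow> F i = 0 \<or> int (degree (F i)) \<le> e"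
    "\<And>i v. i \<le> n \<Longrightarrow> nonzero_vec 1 v \<Longrightarrow> s i v = hom_eval (nat e) (F i) v"
    by metis
  have "(\<lambda>i. if i \<le> n then hom_eval (nat e) (F i) v else 0) \<in> f (punctured_line v)"
    if v: "nonzero_vec 1 v" for v
  proof -
    define x where "x = punctured_line v"
    have x: "x \<in> P1" and vx: "v \<in> x"
      unfolding x_def using v punctured_line_in_proj punctured_line_self by auto
    obtain w where w: "w \<in> f x"
      using proj_nonempty[OF f[OF x]] by blast
    then have wnz: "nonzero_vec n w"
      using proj_memD f[OF x] by blast
    then obtain k where k: "k \<le> n" "w k \<noteq> 0"
      by (auto simp: nonzero_vec_def)
    \<comment> \<open>The fibre is one-dimensional: every coordinate section is a multiple of the
      one nonzero at \<open>w\<close>.\<close>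
    have \<sigma>k: "\<sigma> i x = (\<lambda>z. w i / w k * \<sigma> k x z)" for i
    proof
      fix z
      show "\<sigma> i x z = w i / w k * \<sigma> k x z"
      proof (cases "z \<in> f x")
        case True
        then obtain c where "z = (\<lambda>i. c * w i)"
          using proj_memE[OF f[OF x] w] by blast
        then show ?thesis
          using k True by (simp add: \<sigma>_def)
      qed (simp add: \<sigma>_def)
    qed
    have s: "s i v = w i / w k * s k v" for i
    proof -
      have "\<psi> x (\<sigma> i x) = (\<lambda>z. w i / w k * \<psi> x (\<sigma> k x) z)"
        unfolding \<sigma>k[of i] by (rule scale[OF x sec[OF x]])
      then show ?thesis
        by (simp add: s_def x_def)
    qed
    have "s k v \<noteq> 0"
    proof
      assume 0: "s k v = 0"
      have inM: "\<psi> x (\<sigma> k x) \<in> fibre M x"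
        using bij[OF x] sec[OF x] bij_betwE by blast
      have "\<psi> x (\<sigma> k x) = (\<lambda>z. 0)"
      proof
        fix z
        show "\<psi> x (\<sigma> k x) z = 0"
        proof (cases "z \<in> x")
          case True
          then obtain c where "c \<noteq> 0" "z = (\<lambda>i. c * v i)"
            using proj_memE[OF x vx] by blast
          then show ?thesis
            using inM 0 vx by (simp add: M_def twisting_bundle_def s_def x_def)
        next
          case False
          then show ?thesis
            using inM by (simp add: M_def twisting_bundle_def)
        qed
      qed
      \<comment> \<open>The zero vector is written as a multiple by 0, so that compatibility with
        scalars suffices before injectivity is applied.\<close>
      then have "\<psi> x (\<sigma> k x) = \<psi> x (\<lambda>z. 0 * \<sigma> k x z)"
        by (subst scale[OF x sec[OF x]]) simp
      moreover have "(\<lambda>z. 0 * \<sigma> k x z) \<in> fibre L x"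
        by (simp add: fibL)
      ultimately have "\<sigma> k x = (\<lambda>z. 0 * \<sigma> k x z)"
        using bij[OF x] sec[OF x] by (meson bij_betw_imp_inj_on inj_onD)
      then show False
        using w k by (metis \<sigma>_def mult_zero_left)
    qed
    then have "(\<lambda>i. (s k v / w k) * w i) \<in> f x"
      using k by (intro punctured_line_closed[OF f[OF x] w]) simp
    also have "(\<lambda>i. (s k v / w k) * w i) = (\<lambda>i. if i \<le> n then hom_eval (nat e) (F i) v else 0)"
    proof
      fix i
      show "(s k v / w k) * w i = (if i \<le> n then hom_eval (nat e) (F i) v else 0)"
        using F(2)[of i v, symmetric] s[of i] v wnz by (cases "i \<le> n") (simp_all add: nonzero_vec_def)
    qed
    finally show ?thesis
      unfolding x_def .
  qed
  with F(1) show ?thesis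
    using that by blast
qed

subsection \<open>Vector fields along a very free curve\<close>

text \<open>In each summand of degree \<open>a i\<close> the section \<open>z 1 ^ nat (a i)\<close>,
  suitably scaled, takes any given value at a point with \<open>v 1 \<noteq> 0\<close>. Because
  \<open>a i > 0\<close>, it vanishes at the point \<open>vec2 1 0\<close>. The isomorphism carries
  the resulting section back to a vector field along the curve.\<close>

lemma very_free_vector_field:
  assumes free: "very_free n X f"
    and x: "x \<in> P1" "v \<in> x" "v 1 \<noteq> 0" and D: "D \<in> tangent_space n X (f x)"
  obtains \<theta> where "\<theta> x = D" "\<theta> (punctured_line (vec2 1 0)) = (\<lambda>g. 0)"
    "\<And>y. y \<in> P1 \<Longrightarrow> \<theta> y \<in> tangent_space n X (f y)"
    "\<And>y. y \<in> P1 \<Longrightarrow> regular_section_at (pullback 1 P1 X f (tangent_bundle n X)) y \<theta>"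
proof -
  define E where "E = pullback 1 P1 X f (tangent_bundle n X)"
  obtain l a where a: "\<And>i. i < l \<Longrightarrow> a i > 0"
    and iso: "bundle_iso P1 E (direct_sum l (\<lambda>i. twisting_bundle 1 P1 (a i)))"
    using free unfolding very_free_def ample_on_P1_def E_def by blast
  define G where "G = direct_sum l (\<lambda>i. twisting_bundle 1 (P1 :: 'a pt set) (a i))"
  obtain \<phi> where bij: "\<And>x. x \<in> P1 \<Longrightarrow> bij_betw (\<phi> x) (fibre E x) (fibre G x)"
    and scale: "\<And>x s a. x \<in> P1 \<Longrightarrow> s \<in> fibre E x \<Longrightarrow> \<phi> x (\<lambda>b. a * s b) = (\<lambda>c. a * \<phi> x s c)"
    and reg: "\<And>\<sigma> x. section_of P1 E \<sigma> \<Longrightarrow> x \<in> P1 \<Longrightarrow>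
      regular_section_at E x \<sigma> \<longleftrightarrow> regular_section_at G x (\<lambda>y. \<phi> y (\<sigma> y))"
    using iso unfolding bundle_iso_def G_def by blast
  have fibE: "fibre E y = tangent_space n X (f y)" for y
    by (simp add: E_def pullback_def tangent_bundle_def)
  have fibG: "s \<in> fibre G y \<longleftrightarrow> (\<forall>i<l. (\<forall>v\<in>y. \<forall>c. c \<noteq> 0 \<longrightarrow>
        s (i, \<lambda>i. c * v i) = c powi a i * s (i, v)) \<and> (\<forall>v. v \<notin> y \<longrightarrow> s (i, v) = 0)) \<and>
      (\<forall>i\<ge>l. \<forall>v. s (i, v) = 0)" for s y
    by (auto simp: G_def direct_sum_def twisting_bundle_def)
  define s where "s = \<phi> x D"
  have s: "s \<in> fibre G x"
    unfolding s_def using bij[OF x(1)] D fibE bij_betwE by blast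
  define H where "H i z = s (i, v) / v 1 ^ nat (a i) * z 1 ^ nat (a i)" for i and z :: "nat \<Rightarrow> 'a"
  define \<sigma> where "\<sigma> y = (\<lambda>(i, z). if i < l \<and> z \<in> y then H i z else 0)" for y
  have powi: "c powi a i = c ^ nat (a i)" if "i < l" for i and c :: 'a
    using a[OF that] by (simp add: power_int_def)
  have \<sigma>fib: "\<sigma> y \<in> fibre G y" if "y \<in> P1" for y
    using punctured_line_closed[OF that]
    by (auto simp: fibG \<sigma>_def H_def powi power_mult_distrib)
  have \<sigma>x: "\<sigma> x = s"
  proof
    fix b :: "nat \<times> (nat \<Rightarrow> 'a)"
    obtain i z where b: "b = (i, z)"
      by (cases b)
    show "\<sigma> x b = s b"
    proof (cases "i < l \<and> z \<in> x")
      case True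
      then obtain c where c: "c \<noteq> 0" "z = (\<lambda>i. c * v i)"
        using proj_memE[OF x(1,2)] by blast
      then have "s (i, z) = c powi a i * s (i, v)"
        using s True x(2) by (simp add: fibG)
      then show ?thesis
        using True x(3) c by (simp add: b \<sigma>_def H_def powi power_mult_distrib)
    next
      case False
      then show ?thesis
        using s unfolding b \<sigma>_def fibG by (cases "i < l") auto
    qed
  qed
  define x0 where "x0 = punctured_line (vec2 1 (0 :: 'a))"
  have x0: "x0 \<in> P1"
    unfolding x0_def by (intro punctured_line_in_proj) simp
  have \<sigma>x0: "\<sigma> x0 = (\<lambda>b. 0)"
    using a by (auto simp: fun_eq_iff \<sigma>_def H_def x0_def punctured_line_def)
  define \<theta> where "\<theta> y = inv_into (fibre E y) (\<phi> y) (\<sigma> y)" for y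
  have \<theta>fib: "\<theta> y \<in> fibre E y" and \<phi>\<theta>: "\<phi> y (\<theta> y) = \<sigma> y" if "y \<in> P1" for y
    using bij[OF that] \<sigma>fib[OF that] unfolding \<theta>_def
    by (auto simp: bij_betw_def inv_into_into f_inv_into_f)
  show ?thesis
  proof (rule that)
    show "\<theta> x = D"
      unfolding \<theta>_def \<sigma>x s_def using bij[OF x(1)] D fibE
      by (auto simp: bij_betw_def inv_into_f_f)
    have "\<phi> x0 (\<lambda>g. 0 * \<theta> x0 g) = \<phi> x0 (\<theta> x0)"
      unfolding scale[OF x0 \<theta>fib[OF x0]] \<phi>\<theta>[OF x0] \<sigma>x0 by simp
    moreover have "(\<lambda>g. 0 * \<theta> x0 g) \<in> fibre E x0"
      by (simp add: fibE tangent_space_def)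
    ultimately have "(\<lambda>g. 0 * \<theta> x0 g) = \<theta> x0"
      using bij[OF x0] \<theta>fib[OF x0] by (meson bij_betw_imp_inj_on inj_onD)
    then show "\<theta> (punctured_line (vec2 1 0)) = (\<lambda>g. 0)"
      unfolding x0_def by (metis mult_zero_left)
    show "\<theta> y \<in> tangent_space n X (f y)" if "y \<in> P1" for y
      using \<theta>fib[OF that] fibE by blast
    show "regular_section_at (pullback 1 P1 X f (tangent_bundle n X)) y \<theta>" if y: "y \<in> P1" for y
    proof -
      have "regular_section_at (twisting_bundle 1 P1 (a i)) y (\<lambda>y b. \<phi> y (\<theta> y) (i, b))" if i: "i < l" for i
      proof -
        have "form 1 (nat (a i)) (H i)"
          unfolding H_def [abs_def]
          by (intro form_cmult) (use form_power[OF form_coord[of 1 1], of "nat (a i)"] in simp)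
        then show ?thesis
          by (rule regular_section_twistingI[OF y _ form_one])
            (use a[OF i] i in \<open>auto simp: \<phi>\<theta> \<sigma>_def\<close>)
      qed
      then have "regular_section_at G y (\<lambda>y. \<phi> y (\<theta> y))"
        by (simp add: G_def direct_sum_def)
      then show ?thesis
        using reg[of \<theta> y] \<theta>fib y by (simp add: section_of_def E_def)
    qed
  qed
qed

text \<open>Locally the field is a combination of vector fields on \<open>X\<close> composed with
  \<open>f\<close>; these send \<open>g\<close> to regular functions, and a morphism pulls regular
  functions back to regular functions.\<close>

lemma pullback_vector_field_regular:
  fixes f :: "'k::field pt \<Rightarrow> 'k pt"
  assumes f: "morphism 1 P1 n X f" and x: "x \<in> P1" "v \<in> x"
    and \<theta>: "regular_section_at (pullback 1 P1 X f (tangent_bundle n X)) x \<theta>"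
    and g: "regular_at n X (f x) g"
  shows "rational_at 0 v (\<lambda>z. \<theta> (punctured_line z) g)"
proof -
  have "\<exists>(l::nat) h \<tau> U. (\<forall>j<l. regular_at 1 P1 x (h j) \<and> section_of X (tangent_bundle n X) (\<tau> j) \<and>
      regular_section_at (tangent_bundle n X) (f x) (\<tau> j)) \<and> zopen 1 P1 U \<and> x \<in> U \<and>
      (\<forall>y\<in>U. \<theta> y = (\<lambda>b. \<Sum>j<l. h j y * \<tau> j (f y) b))"
    using \<theta> by (simp add: pullback_def)
  then obtain l :: nat and h \<tau> U where h: "\<And>j. j < l \<Longrightarrow> regular_at 1 P1 x (h j)"
    and \<tau>: "\<And>j. j < l \<Longrightarrow> regular_section_at (tangent_bundle n X) (f x) (\<tau> j)"
    and U: "zopen 1 P1 U" "x \<in> U"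
    and eq: "\<And>y. y \<in> U \<Longrightarrow> \<theta> y = (\<lambda>b. \<Sum>j<l. h j y * \<tau> j (f y) b)"
    by blast
  obtain k S where S: "form 1 k S" "\<forall>v\<in>x. S v \<noteq> 0"
    "\<And>y. y \<in> P1 \<Longrightarrow> \<forall>v\<in>y. S v \<noteq> 0 \<Longrightarrow> y \<in> U"
    using zopenE[OF U] by metis
  have v: "nonzero_vec 1 v"
    using proj_memD x by blast
  have \<tau>g: "regular_at 1 P1 x (\<lambda>y. \<tau> j (f y) g)" if "j < l" for j
  proof -
    have "regular_at n X (f x) (\<lambda>y. \<tau> j y g)"
      using \<tau>[OF that] g by (simp add: tangent_bundle_def)
    then show ?thesis
      using f x(1) unfolding morphism_def by blast
  qed
  have "rational_at (0 + 0) v (\<lambda>z. h j (punctured_line z) * \<tau> j (f (punctured_line z)) g)"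
    if "j < l" for j
    by (intro rational_at_mult regular_at_imp_rational_at[OF h[OF that] x(2)]
        regular_at_imp_rational_at[OF \<tau>g[OF that] x(2)])
  then have "rational_at 0 v (\<lambda>z. \<Sum>j<l. h j (punctured_line z) * \<tau> j (f (punctured_line z)) g)"
    by (intro rational_at_sum v) auto
  then show ?thesis
  proof (rule rational_at_local[OF _ S(1)])
    show "S v \<noteq> 0"
      using S(2) x by blast
    fix z :: "nat \<Rightarrow> 'k"
    assume z: "nonzero_vec 1 z" "S z \<noteq> 0"
    have "punctured_line z \<in> U"
      using form_nonzero_on_line[OF S(1) punctured_line_in_proj[OF z(1)] punctured_line_self _ z(2)]
      by (intro S(3) punctured_line_in_proj z) auto
    then show "\<theta> (punctured_line z) g =
        (\<Sum>j<l. h j (punctured_line z) * \<tau> j (f (punctured_line z)) g)"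
      using eq by simp
  qed
qed

subsection \<open>Cosections of the pulled back tangent bundle\<close>

text \<open>
  The \<open>B i\<close> and \<open>C i\<close> represent a section of the dual of the kernel bundle of the \<open>(F i)^q\<close> on the
  two charts of the projective line: they agree there because \<open>B i / t^k\<close> and \<open>- C i / s^k\<close> differ
  by a multiple of \<open>F i\<close>. Contracted with a vector field along the curve this gives a section of a line
  bundle of degree \<open>e - q (k - (e - 1)) \<le> 0\<close>, which vanishes wherever the vector field does.
\<close>

lemma very_free_cosection_vanishes:
  fixes X :: "'k::alg_closed_field pt set"
  assumes char: "CHAR('k) > 0" and q: "q = CHAR('k) ^ r" "of_nat q = (0 :: 'k)" "q > 0"
    and X: "X = fermat_hypersurface (q + 1) n"
    and f: "morphism 1 P1 n X f" and free: "very_free n X f"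
    and degF: "\<And>i. i \<le> n \<Longrightarrow> degree (F i) \<le> e" and e: "e > 0"
    and F: "\<And>v. nonzero_vec 1 v \<Longrightarrow>
      (\<lambda>i. if i \<le> n then hom_eval e (F i) v else 0) \<in> f (punctured_line v)"
    and deg\<Lambda>: "degree \<Lambda> < k"
    and split: "\<And>i. i \<le> n \<Longrightarrow> F i * \<Lambda> = B i + monom 1 k * C i"
    and degB: "\<And>i. i \<le> n \<Longrightarrow> degree (B i) \<le> e - 1"
    and degC: "\<And>i. i \<le> n \<Longrightarrow> degree (C i) \<le> e - 1"
    and orthB: "(\<Sum>i\<le>n. B i ^ q * F i) = 0" and orthC: "(\<Sum>i\<le>n. C i ^ q * F i) = 0"
    and le: "q * (e - 1) + e \<le> q * k"
    and v: "nonzero_vec 1 v" "v 1 \<noteq> 0"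
    and w: "\<forall>i>n. w i = 0" "(\<Sum>i\<le>n. hom_eval e (F i) v ^ q * w i) = 0"
  shows "(\<Sum>i\<le>n. hom_eval (e - 1) (B i) v ^ q * w i) = 0"
proof -
  have frob: "(x + y) ^ q = x ^ q + y ^ q" for x y :: 'k
    by (rule freshmans_dream') (use prime_CHAR_semidom[OF char] q in simp_all)
  have XP: "X \<subseteq> proj n"
    unfolding X by (rule fermat_hypersurface_subset)
  define Fv where "Fv v i = (if i \<le> n then hom_eval e (F i) v else 0)" for v i
  have fX: "f x \<in> X" if "x \<in> P1" for x
    using f that unfolding morphism_def by blast
  have Fin: "Fv z \<in> f (punctured_line z)" if "nonzero_vec 1 z" for z
    using F[OF that] unfolding Fv_def .
  have Fnz: "\<exists>c\<le>n. Fv z c \<noteq> 0" if "nonzero_vec 1 z" for z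
    using proj_memD(2)[OF _ Fin[OF that]] fX punctured_line_in_proj[OF that] XP
    by (auto simp: nonzero_vec_def)
  define Bv where "Bv i z = hom_eval (e - 1) (B i) z / z 1 ^ k" for i z
  define Cv where "Cv i z = - hom_eval (e - 1) (C i) z / z 0 ^ k" for i z
  have formF: "form 1 e (\<lambda>z. Fv z c)" if "c \<le> n" for c
    using that form_hom_eval[of e "F c"] by (simp add: Fv_def [abs_def])
  have orthBv: "(\<Sum>i\<le>n. Bv i z ^ q * Fv z i) = 0" for z
  proof -
    have "(\<Sum>i\<le>n. Bv i z ^ q * Fv z i) =
        (\<Sum>i\<le>n. hom_eval (e - 1) (B i) z ^ q * hom_eval e (F i) z) / z 1 ^ (k * q)"
      by (simp add: Bv_def Fv_def power_divide power_mult sum_divide_distrib)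
    then show ?thesis
      using hom_eval_frobenius_sum[OF orthB, of "e - 1" e z] degB degF by simp
  qed
  have orthCv: "(\<Sum>i\<le>n. Cv i z ^ q * Fv z i) = 0" for z
  proof -
    have "(\<Sum>i\<le>n. Cv i z ^ q * Fv z i) =
        (- 1) ^ q * (\<Sum>i\<le>n. hom_eval (e - 1) (C i) z ^ q * hom_eval e (F i) z) / z 0 ^ (k * q)"
      unfolding sum_distrib_left sum_divide_distrib
    proof (intro sum.cong refl)
      fix i
      have "Cv i z ^ q = (- 1) ^ q * hom_eval (e - 1) (C i) z ^ q / z 0 ^ (k * q)"
        unfolding Cv_def power_divide power_mult by (subst power_minus) simp
      then show "Cv i z ^ q * Fv z i =
          (- 1) ^ q * (hom_eval (e - 1) (C i) z ^ q * hom_eval e (F i) z) / z 0 ^ (k * q)"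
        if "i \<in> {..n}"
        using that by (simp add: Fv_def mult.assoc)
    qed
    then show ?thesis
      using hom_eval_frobenius_sum[OF orthC, of "e - 1" e z] degC degF by simp
  qed
  have glue: "Bv i z = hom_eval (k - 1) \<Lambda> z / (z 0 * z 1) ^ k * Fv z i + Cv i z"
    if "i \<le> n" "z 0 \<noteq> 0" "z 1 \<noteq> 0" for i z
  proof -
    \<comment> \<open>Two ways to write the degree of the product form: \<Lambda> is homogenised in
      degree \<open>k - 1\<close>, \<open>B i\<close> and \<open>C i\<close> in degree
      \<open>e - 1\<close>.\<close>
    have k: "e + (k - 1) = k + (e - 1)"
      using deg\<Lambda> e by linarith
    have "hom_eval e (F i) z * hom_eval (k - 1) \<Lambda> z = hom_eval (k + (e - 1)) (F i * \<Lambda>) z"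
      using hom_eval_mult[OF degF[OF that(1)], of \<Lambda> "k - 1" z] deg\<Lambda> unfolding k by simp
    also have "\<dots> = z 0 ^ k * hom_eval (e - 1) (B i) z + z 1 ^ k * hom_eval (e - 1) (C i) z"
      using hom_eval_mult[of 1 k "B i" "e - 1" z] degB[OF that(1)]
        hom_eval_mult[of "monom 1 k" k "C i" "e - 1" z] degC[OF that(1)]
      by (simp add: split[OF that(1)] hom_eval_add hom_eval_one hom_eval_monom degree_monom_le)
    finally show ?thesis
      using that by (simp add: Bv_def Cv_def Fv_def power_mult_distrib field_simps)
  qed
  define x where "x = punctured_line v"
  have x: "x \<in> P1" "v \<in> x"
    unfolding x_def using v punctured_line_in_proj punctured_line_self by auto
  define D where "D = tangent_vector n X (f x) (Fv v) w"
  have Fvfx: "Fv v \<in> f x"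
    unfolding x_def by (rule Fin[OF v(1)])
  have w': "(\<Sum>i\<le>n. Fv v i ^ q * w i) = 0"
    using w(2) by (simp add: Fv_def)
  have D: "D \<in> tangent_space n X (f x)"
    unfolding D_def
    by (rule tangent_vector_in_tangent_space[OF X q(2,3) fX[OF x(1)] Fvfx w(1) w'])
  obtain \<theta> where \<theta>: "\<theta> x = D" "\<theta> (punctured_line (vec2 1 0)) = (\<lambda>g. 0)"
    "\<And>y. y \<in> P1 \<Longrightarrow> \<theta> y \<in> tangent_space n X (f y)"
    "\<And>y. y \<in> P1 \<Longrightarrow> regular_section_at (pullback 1 P1 X f (tangent_bundle n X)) y \<theta>"
    by (rule very_free_vector_field[OF free x v(2) D], rule that)
  \<comment> \<open>The ambient lift of the tangent vector over \<open>z\<close> in the chart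
    \<open>c\<close>; the factor \<open>Fv z c\<close> makes it homogeneous of degree
    \<open>e\<close>.\<close>
  define T where "T c z a = Fv z c * \<theta> (punctured_line z) (coord_ratio a c)" for c z a
  define ch where "ch z = (LEAST c. c \<le> n \<and> Fv z c \<noteq> 0)" for z
  have ch: "ch z \<le> n" "Fv z (ch z) \<noteq> 0" if "nonzero_vec 1 z" for z
    using LeastI_ex[OF Fnz[OF that, unfolded Bex_def]] unfolding ch_def by auto
  define \<rho> where "\<rho> z = (\<Sum>a\<le>n. (if z 1 \<noteq> 0 then Bv a z else Cv a z) ^ q * T (ch z) z a)" for z
  \<comment> \<open>A change of chart adds a multiple of \<open>Fv z\<close> to the lift, and the
    weights \<open>g a ^ q\<close> are orthogonal to \<open>Fv z\<close>. So the choice made by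
    \<open>ch\<close> is immaterial.\<close>
  have chart: "(\<Sum>a\<le>n. g a ^ q * T c z a) = (\<Sum>a\<le>n. g a ^ q * T c' z a)"
    if z: "nonzero_vec 1 z" and c: "c \<le> n" "Fv z c \<noteq> 0" "c' \<le> n" "Fv z c' \<noteq> 0"
      and g: "(\<Sum>a\<le>n. g a ^ q * Fv z a) = 0" for g c c' z
  proof -
    define y where "y = punctured_line z"
    have y: "y \<in> P1"
      unfolding y_def using z by (rule punctured_line_in_proj)
    define K where "K = Fv z c / Fv z c' * \<theta> y (coord_ratio c' c)"
    have "T c z a = Fv z a * K + T c' z a" if "a \<le> n" for a
      unfolding T_def K_def y_def[symmetric]
      by (rule tangent_space_change_chart[OF XP fX[OF y] Fin[OF z, folded y_def] \<theta>(3)[OF y] c that])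
    then have "(\<Sum>a\<le>n. g a ^ q * T c z a) =
        (\<Sum>a\<le>n. g a ^ q * Fv z a * K + g a ^ q * T c' z a)"
      by (intro sum.cong) (auto simp: algebra_simps)
    also have "\<dots> = (\<Sum>a\<le>n. g a ^ q * Fv z a) * K + (\<Sum>a\<le>n. g a ^ q * T c' z a)"
      by (simp add: sum.distrib sum_distrib_right)
    finally show ?thesis
      using g by simp
  qed
  have \<rho>B: "\<rho> z = (\<Sum>a\<le>n. Bv a z ^ q * T c z a)"
    if "nonzero_vec 1 z" "z 1 \<noteq> 0" "c \<le> n" "Fv z c \<noteq> 0" for c z
    using chart[OF that(1) ch[OF that(1)] that(3,4) orthBv] that(2) by (simp add: \<rho>_def)
  have \<rho>C: "\<rho> z = (\<Sum>a\<le>n. Cv a z ^ q * T c z a)"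
    if z: "nonzero_vec 1 z" "z 0 \<noteq> 0" and c: "c \<le> n" "Fv z c \<noteq> 0" for c z
  proof (cases "z 1 = 0")
    case True
    then show ?thesis
      using chart[OF z(1) ch[OF z(1)] c orthCv] by (simp add: \<rho>_def)
  next
    case False
    define y where "y = punctured_line z"
    have y: "y \<in> P1"
      unfolding y_def using z(1) by (rule punctured_line_in_proj)
    define K where "K = (hom_eval (k - 1) \<Lambda> z / (z 0 * z 1) ^ k) ^ q"
    \<comment> \<open>After Frobenius the discrepancy between \<open>Bv\<close> and
      \<open>Cv\<close> is \<open>K * Fv z a ^ q\<close>, which pairs to zero with tangent vectors
      of the hypersurface.\<close>
    have "(\<Sum>a\<le>n. Fv z a ^ q * \<theta> y (coord_ratio a c)) = 0"
      by (rule tangent_space_fermat[OF X q(2) fX[OF y] Fin[OF z(1), folded y_def] \<theta>(3)[OF y],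
          where c = c]) (use c in auto)
    moreover have "(\<Sum>a\<le>n. K * (Fv z a ^ q * T c z a)) =
        K * Fv z c * (\<Sum>a\<le>n. Fv z a ^ q * \<theta> y (coord_ratio a c))"
      unfolding sum_distrib_left by (intro sum.cong) (simp_all add: T_def y_def)
    ultimately have "(\<Sum>a\<le>n. K * (Fv z a ^ q * T c z a)) = 0"
      by simp
    moreover have "Bv a z ^ q * T c z a = K * (Fv z a ^ q * T c z a) + Cv a z ^ q * T c z a"
      if "a \<le> n" for a
      unfolding glue[OF that z(2) False] frob K_def
        power_mult_distrib[of "hom_eval (k - 1) \<Lambda> z / (z 0 * z 1) ^ k"]
      by (simp only: distrib_right mult.assoc)
    ultimately show ?thesis
      unfolding \<rho>B[OF z(1) False c] by (simp add: sum.distrib)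
  qed
  have rational_T: "rational_at (int e) z (\<lambda>z. T c z a)"
    if z: "nonzero_vec 1 z" and c: "c \<le> n" "Fv z c \<noteq> 0" and a: "a \<le> n" for z c a
  proof -
    define y where "y = punctured_line z"
    have y: "y \<in> P1" "z \<in> y"
      unfolding y_def using z punctured_line_in_proj punctured_line_self by auto
    have "regular_at n X (f y) (coord_ratio a c)"
      by (rule regular_at_coord_ratio[OF XP fX[OF y(1)] Fin[OF z, folded y_def]]) (use a c in auto)
    from pullback_vector_field_regular[OF f y \<theta>(4)[OF y(1)] this]
    have "rational_at (int e + 0) z (\<lambda>z. T c z a)"
      unfolding T_def by (intro rational_at_mult rational_at_form formF c)
    then show ?thesis
      by simp
  qed
  \<comment> \<open>\<open>Bv\<close> and \<open>Cv\<close> have degree \<open>(e - 1) - k\<close>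
    and enter with exponent \<open>q\<close>; the lift contributes \<open>e\<close>.\<close>
  define d where "d = int q * (int (e - 1) - int k) + int e"
  have rational_\<rho>: "rational_at d z \<rho>" if z: "nonzero_vec 1 z" for z
  proof -
    obtain c where c: "c \<le> n" "Fv z c \<noteq> 0"
      using Fnz[OF z] by blast
    have sum: "rational_at d z (\<lambda>z. \<Sum>a\<le>n. h a z ^ q * T c z a)"
      if "\<And>a. a \<le> n \<Longrightarrow> rational_at (int (e - 1) - int k) z (h a)" for h
      unfolding d_def using that
      by (intro rational_at_sum[OF z] rational_at_mult rational_at_power rational_T z c) auto
    have quot: "rational_at (int (e - 1) - int k) z (\<lambda>z. hom_eval (e - 1) p z / z j ^ k)"
      if "j \<le> 1" "z j \<noteq> 0" for j p
    proof -
      have "form 1 k (\<lambda>z. z j ^ k)"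
        using form_power[OF form_coord[OF that(1)], of k] by simp
      from rational_at_mult[OF rational_at_form[OF form_hom_eval[of "e - 1" p], of z]
          rational_at_inverse[OF this, of z]]
      show ?thesis
        using that(2) by simp
    qed
    show ?thesis
    proof (cases "z 1 = 0")
      case False
      have "rational_at d z (\<lambda>z. \<Sum>a\<le>n. Bv a z ^ q * T c z a)"
        unfolding Bv_def using False by (intro sum quot) auto
      then show ?thesis
      proof (rule rational_at_local[OF _ form_mult[OF form_coord[of 1 1] formF[OF c(1)]]])
        show "z 1 * Fv z c \<noteq> 0"
          using False c by simp
      qed (use \<rho>B c in auto)
    next
      case True
      then have z0: "z 0 \<noteq> 0"
        using nonzero_vec_1_eq[OF z] z by (metis nonzero_vec2)
      have "rational_at d z (\<lambda>z. \<Sum>a\<le>n. Cv a z ^ q * T c z a)"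
        unfolding Cv_def minus_divide_left[symmetric] hom_eval_uminus[symmetric]
        using z0 by (intro sum quot) auto
      then show ?thesis
      proof (rule rational_at_local[OF _ form_mult[OF form_coord[of 0 1] formF[OF c(1)]]])
        show "z 0 * Fv z c \<noteq> 0"
          using z0 c by simp
      qed (use \<rho>C c in auto)
    qed
  qed
  have d: "d \<le> 0"
    using le unfolding d_def by (simp add: algebra_simps flip: of_nat_mult of_nat_add)
  obtain g where g: "g = 0 \<or> int (degree g) \<le> d"
    "\<And>z. nonzero_vec 1 z \<Longrightarrow> \<rho> z = hom_eval (nat d) g z"
    using global_section_form[of d \<rho>] rational_\<rho> by metis
  \<comment> \<open>Since \<open>d \<le> 0\<close>, \<open>nat d\<close> is 0 and only the constant
    coefficient survives; the zero of the vector field at \<open>vec2 1 0\<close> then determines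
    it.\<close>
  have const: "\<rho> z = coeff g 0" if "nonzero_vec 1 z" for z
    using g(2)[OF that] d by (simp add: hom_eval_def)
  have "\<rho> (vec2 1 0) = 0"
    by (simp add: \<rho>_def T_def \<theta>(2))
  then have "\<rho> v = 0"
    using const[OF v(1)] const[of "vec2 1 0"] by simp
  obtain c where c: "c \<le> n" "Fv v c \<noteq> 0"
    using Fnz[OF v(1)] by blast
  \<comment> \<open>Lifting the derivation induced by \<open>w\<close> returns \<open>w\<close> up
    to a multiple of \<open>Fv v\<close>, which \<open>orthBv\<close> removes.\<close>
  have T: "T c v a = w a - Fv v a * (w c / Fv v c)" if "a \<le> n" for a
  proof -
    have "coord_ratio a c (f x) = Fv v a / Fv v c"
      using coord_ratio_eq[of "f x" n "Fv v"] fX[OF x(1)] XP Fvfx by blast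
    then have "D (coord_ratio a c) = (w a - Fv v a / Fv v c * w c) / Fv v c"
      unfolding D_def
      using tangent_vector_eq[OF X q(2,3) fX[OF x(1)] Fvfx w(1) w'
          fraction_at_coord_ratio[OF XP fX[OF x(1)] Fvfx c(2) that c(1)]]
      by (simp add: dir_deriv_coord)
    then show ?thesis
      using c by (simp add: T_def \<theta>(1) flip: x_def)
  qed
  have "0 = (\<Sum>a\<le>n. Bv a v ^ q * T c v a)"
    using \<rho>B[OF v c] \<open>\<rho> v = 0\<close> by simp
  also have "\<dots> = (\<Sum>a\<le>n. Bv a v ^ q * w a - Bv a v ^ q * Fv v a * (w c / Fv v c))"
    by (intro sum.cong) (auto simp: T algebra_simps)
  also have "\<dots> = (\<Sum>a\<le>n. Bv a v ^ q * w a)"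
    unfolding sum_subtractf sum_distrib_right[symmetric] orthBv by simp
  also have "\<dots> = (\<Sum>a\<le>n. hom_eval (e - 1) (B a) v ^ q * w a) / v 1 ^ (k * q)"
    by (simp add: Bv_def power_divide power_mult sum_divide_distrib)
  finally show ?thesis
    using v(2) by simp
qed

theorem theorem1p7:
  fixes f :: "'k::alg_closed_field pt \<Rightarrow> 'k pt"
    and p r d N :: nat and e m :: int and X :: "'k pt set"
  assumes "CHAR('k) = p" and "p > 0"
    and "r \<ge> 1" and "p ^ r + 1 > 3"
    and "d = p ^ r + 1" and "N = p ^ r + 1"
    and "X = fermat_hypersurface d N"
    and "rational_curve N X f" and "curve_degree N f e"
    and "0 \<le> m" and "m \<le> int N - 3"
    and "m * int N < e" and "e \<le> (m + 1) * (int N - 1)"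
  shows "\<not> very_free N X f"
proof
  assume free: "very_free N X f"
  define q where "q = p ^ r"
  have N: "N = q + 1" and X: "X = fermat_hypersurface (q + 1) N"
    using assms by (simp_all add: q_def)
  have char: "CHAR('k) > 0" and q: "q = CHAR('k) ^ r"
    using assms by (simp_all add: q_def)
  have q0: "of_nat q = (0 :: 'k)" "q > 0"
    using assms by (auto simp: q_def)
  have frob: "(x + y) ^ q = x ^ q + y ^ q" for x y :: 'k
    by (rule freshmans_dream') (use prime_CHAR_semidom[OF char] q in simp_all)
  have f: "morphism 1 P1 N X f"
    using assms by (simp add: rational_curve_def)
  have XP: "X \<subseteq> proj N"
    unfolding X by (rule fermat_hypersurface_subset)
  have fX: "f x \<in> X" if "x \<in> P1" for x
    using f that unfolding morphism_def by blast
  define m' e' where "m' = nat m" and "e' = nat e"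
  have e_pos: "e > 0"
    using assms by (metis mult_nonneg_nonneg of_nat_0_le_iff order_le_less_trans)
  have m: "m = int m'" and e: "e = int e'" and e'0: "e' > 0"
    using assms e_pos by (simp_all add: m'_def e'_def)
  have "int (m' * (q + 1)) < int e'" "int e' \<le> int ((m' + 1) * q)"
    using assms by (simp_all add: m e N q_def algebra_simps)
  then have me: "m' * (q + 1) < e'" "e' \<le> (m' + 1) * q"
    by (simp_all only: of_nat_less_iff of_nat_le_iff)
  have mq: "m' + 2 \<le> q"
    using assms(11) by (simp add: m N)
  obtain F where F: "\<And>i. i \<le> N \<Longrightarrow> F i = 0 \<or> int (degree (F i)) \<le> e"
    "\<And>v. nonzero_vec 1 v \<Longrightarrow>
      (\<lambda>i. if i \<le> N then hom_eval (nat e) (F i) v else 0) \<in> f (punctured_line v)"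
    using curve_degree_forms[OF assms(9)] fX XP by blast
  have degF: "degree (F i) \<le> e'" if "i \<le> N" for i
    using F(1)[OF that] by (auto simp: e)
  have Fin: "(\<lambda>i. if i \<le> N then hom_eval e' (F i) v else 0) \<in> f (punctured_line v)"
    if "nonzero_vec 1 v" for v
    using F(2)[OF that] unfolding e'_def .
  have Fnz: "\<exists>c\<le>N. hom_eval e' (F c) z \<noteq> 0" if "nonzero_vec 1 z" for z
  proof -
    have "f (punctured_line z) \<in> proj N"
      using fX[OF punctured_line_in_proj[OF that]] XP by blast
    from proj_memD(2)[OF this Fin[OF that]] show ?thesis
      by (auto simp: nonzero_vec_def split: if_splits)
  qed
  have aff: "hom_eval e' (F i) (vec2 1 t) = poly (F i) t" if "i \<le> N" for i and t :: 'k
    using degF[OF that] by (simp add: hom_eval_affine)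
  have fermat: "(\<Sum>i\<le>N. F i ^ (q + 1)) = 0"
  proof (rule poly_eq_0_if_vanishing)
    fix t :: 'k
    have nz: "nonzero_vec 1 (vec2 1 t)"
      by simp
    have "(\<Sum>i\<le>N. (if i \<le> N then hom_eval e' (F i) (vec2 1 t) else 0) ^ (q + 1)) = 0"
      using fermat_hypersurface_memD[OF _ Fin[OF nz]] fX[OF punctured_line_in_proj[OF nz]] X
      by blast
    also have "(\<Sum>i\<le>N. (if i \<le> N then hom_eval e' (F i) (vec2 1 t) else 0) ^ (q + 1)) =
        (\<Sum>i\<le>N. poly (F i) t ^ (q + 1))"
      by (intro sum.cong) (auto simp: aff)
    finally show "poly (\<Sum>i\<le>N. F i ^ (q + 1)) t = 0"
      by (simp add: poly_sum)
  qed
  obtain \<Lambda> B C where \<Lambda>: "\<Lambda> \<noteq> 0" "degree \<Lambda> < e' + m'"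
    and split: "\<And>i. i \<le> N \<Longrightarrow> F i * \<Lambda> = B i + monom 1 (e' + m') * C i"
    and degB: "\<And>i. i \<le> N \<Longrightarrow> degree (B i) \<le> e' - 1"
    and degC: "\<And>i. i \<le> N \<Longrightarrow> degree (C i) \<le> e' - 1"
    and orth: "(\<Sum>i\<le>N. B i ^ q * F i) = 0" "(\<Sum>i\<le>N. C i ^ q * F i) = 0"
    by (rule frobenius_syzygy[OF char q _ _ me mq, folded N, OF degF fermat[folded N]], assumption, rule that)
  have "q * (e' - 1) + e' \<le> q * (e' + m')"
  proof -
    have "q * (e' - 1) + q = q * e'"
      using e'0 by (cases e') auto
    then show ?thesis
      using me(2) by (simp add: algebra_simps)
  qed
  note cosection = very_free_cosection_vanishes[OF char q q0 X f free degF e'0 Fin \<Lambda>(2) split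
      degB degC orth this]
  have cross: "B a * F c = B c * F a" if ac: "a \<le> N" "c \<le> N" for a c
  proof -
    \<comment> \<open>The extra factor takes care of \<open>t = 0\<close>, the point where the
      vector field was made to vanish and \<open>cosection\<close> gives nothing.\<close>
    have "[:0, 1:] * (B a * F c - B c * F a) = 0"
    proof (rule poly_eq_0_if_vanishing)
      fix t
      show "poly ([:0, 1:] * (B a * F c - B c * F a)) t = 0"
      proof (cases "t = 0 \<or> a = c")
        case False
        \<comment> \<open>A tangent vector with only the coordinates \<open>a\<close> and
          \<open>c\<close>, chosen so that its pairing with the \<open>q\<close>-th powers of the
          \<open>F i\<close> cancels.\<close>
        define w where "w i = (if i = a then poly (F c) t ^ q
          else if i = c then - (poly (F a) t ^ q) else 0)" for i
        have two: "(\<Sum>i\<le>N. g i * w i) = g a * poly (F c) t ^ q - g c * poly (F a) t ^ q" for g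
        proof -
          have "(\<Sum>i\<le>N. g i * w i) = (\<Sum>i\<in>{a, c}. g i * w i)"
            using ac by (intro sum.mono_neutral_right) (auto simp: w_def)
          then show ?thesis
            using False by (auto simp: w_def)
        qed
        have affB: "hom_eval (e' - 1) (B i) (vec2 1 t) = poly (B i) t" if "i \<le> N" for i
          using degB[OF that] by (simp add: hom_eval_affine)
        have "(\<Sum>i\<le>N. hom_eval (e' - 1) (B i) (vec2 1 t) ^ q * w i) = 0"
        proof (rule cosection)
          show "\<forall>i>N. w i = 0"
            using ac by (auto simp: w_def)
          show "(\<Sum>i\<le>N. hom_eval e' (F i) (vec2 1 t) ^ q * w i) = 0"
            unfolding two using ac by (simp add: aff mult.commute)
        qed (use False in auto)
        then have "(poly (B a) t * poly (F c) t) ^ q = (poly (B c) t * poly (F a) t) ^ q"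
          unfolding two affB[OF ac(1)] affB[OF ac(2)] by (simp add: power_mult_distrib)
        \<comment> \<open>Additivity of Frobenius turns the equality of \<open>q\<close>-th powers
          into the vanishing of the \<open>q\<close>-th power of the difference.\<close>
        moreover have "(poly (B a) t * poly (F c) t) ^ q =
            (poly (B a) t * poly (F c) t - poly (B c) t * poly (F a) t) ^ q
              + (poly (B c) t * poly (F a) t) ^ q"
          using frob[of "poly (B a) t * poly (F c) t - poly (B c) t * poly (F a) t"
              "poly (B c) t * poly (F a) t"] by simp
        ultimately show ?thesis
          using q0(2) by simp
      qed auto
    qed
    then show ?thesis
      by simp
  qed
  have nozero: "\<exists>a\<le>N. poly (F a) t \<noteq> 0" for t
    using Fnz[of "vec2 1 t"] aff by auto
  \<comment> \<open>Since the forms have no common zero at infinity, some \<open>F c\<close> has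
    full degree \<open>e'\<close>, which exceeds the degree of \<open>B c\<close>.\<close>
  obtain c where c: "c \<le> N" "coeff (F c) e' \<noteq> 0"
    using Fnz[of "vec2 0 1"] by (auto simp: hom_eval_infinity)
  then have "degree (B c) < degree (F c)"
    using degB[OF c(1)] le_degree[OF c(2)] e'0 by linarith
  then have B0: "B a = 0" if "a \<le> N" for a
    using proportional_polys_vanish[of N B F c a] cross nozero c(1) that by blast
  obtain a where a: "a \<le> N" "poly (F a) 0 \<noteq> 0"
    using nozero[of 0] by blast
  then have "monom 1 (e' + m') dvd F a * \<Lambda>"
    by (simp add: split B0)
  then have "\<Lambda> = 0"
    using a(2) \<Lambda>(2) by (rule eq_0_if_monom_dvd_mult)
  with \<Lambda>(1) show False
    by contradiction
qed

end
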